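(* Let $H$ be a real Hilbert space and let $F=f+g$, where $f:H\to\mathbb{R}$ is convex and $L$-smooth ($L>0$), and $g:H\to\mathbb{R}\cup\{\infty\}$ is convex, proper and lower-semicontinuous. Assume that $\operatorname{argmin}_{x\in H}F(x)$ is nonempty. Let $s\in\left(0,\frac1L\right]$, $m\in(0,1]$, let $(t_k)_{k\ge 0}$ be defined by $t_0=1$ and $t_k=\frac{m+\sqrt{m^2+4t_{k-1}^2}}{2}$ for $k\ge 1$, and set $\lambda_{k+1}=\frac{t_k-1}{t_{k+1}}$ for $k\ge 0$. Let $\gamma_0=s$ and $\gamma_{k+1}=(1+\lambda_{k+1})s$ for $k\ge 0$. Let $y_0\in H$, $z_0=y_0-\gamma_0\nabla f(y_0)$, $x_0=\operatorname{prox}_{\gamma_0 g}(z_0)$, and let $(x_k)_{k\ge0}$, $(y_k)_{k\ge 0}$, $(z_k)_{k\ge 0}$ be generated, for $k\ge 0$, by $$\begin{aligned} y_{k+1} &= x_k-s\nabla f(x_k),\\ z_{k+1} &= y_{k+1}+\lambda_{k+1}(y_{k+1}-y_k)+\frac{\lambda_{k+1}s}{\gamma_k}(z_k-x_k),\\ x_{k+1} &= \operatorname{prox}_{\gamma_{k+1}g}(z_{k+1}).\end{aligned}$$ Then $x_k$ converges weakly, as $k\to\infty$, to a minimizer $x^*$ of $F$. Moreover, $y_k$ and $z_k$ converge weakly, as $k\to\infty$, to $y^*:=x^*-s\nabla f(x^* )$ and $z^*:=x^*-2s\nabla f(x^* )$, respectively.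
   Context: $L$-smooth means that $f$ is (Fréchet) differentiable with $L$-Lipschitz continuous gradient $\nabla f$. For $\gamma>0$, $\operatorname{prox}_{\gamma g}(z)=\operatorname{argmin}_{x\in H}\left\{\gamma g(x)+\frac12\|x-z\|^2\right\}$ for $z\in H$. *)

theory Defs
  imports "HOL-Analysis.Analysis"
begin

text \<open>A real Hilbert space is a type of sort \<open>{real_inner, complete_space}\<close>; it may be
  infinite-dimensional and non-separable.\<close>

text \<open>Meaningful wherever \<open>f\<close> is differentiable: on a Hilbert space the gradient then exists
  by Riesz representation, and it is unique.\<close>

definition gradient :: "('a::real_inner \<Rightarrow> real) \<Rightarrow> 'a \<Rightarrow> 'a" where
  "gradient f x = (THE D. GDERIV f x :> D)"

definition smooth_with :: "real \<Rightarrow> ('a::real_inner \<Rightarrow> real) \<Rightarrow> bool" where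
  "smooth_with L f \<longleftrightarrow> (\<forall>x. f differentiable (at x)) \<and> L-lipschitz_on UNIV (gradient f)"

definition proper_fun :: "('a \<Rightarrow> ereal) \<Rightarrow> bool" where
  "proper_fun g \<longleftrightarrow> (\<forall>x. g x \<noteq> -\<infinity>) \<and> (\<exists>x. g x \<noteq> \<infinity>)"

text \<open>Intended for functions that avoid \<open>-\<infinity>\<close>. In \<open>ereal\<close> we have \<open>0 * \<infinity> = 0\<close>, so the
  inequality is trivially true for \<open>u = 0\<close> and for \<open>v = 0\<close>.\<close>

definition convex_ereal :: "('a::real_vector \<Rightarrow> ereal) \<Rightarrow> bool" where
  "convex_ereal g \<longleftrightarrow> (\<forall>x y. \<forall>u\<ge>0. \<forall>v\<ge>0. u + v = 1 \<longrightarrow>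
     g (u *\<^sub>R x + v *\<^sub>R y) \<le> ereal u * g x + ereal v * g y)"

definition lsc :: "('a::topological_space \<Rightarrow> ereal) \<Rightarrow> bool" where
  "lsc g \<longleftrightarrow> (\<forall>x. g x \<le> Liminf (at x) g)"

definition argmin_set :: "('a \<Rightarrow> ereal) \<Rightarrow> 'a set" where
  "argmin_set h = {x. is_arg_min h (\<lambda>_. True) x}"

text \<open>\<open>prox \<gamma> g z\<close> is the proximal operator of the function \<open>\<gamma> g\<close> at \<open>z\<close>.
  For \<open>\<gamma> > 0\<close> and \<open>g\<close> proper, convex and lower semicontinuous on a Hilbert space the minimizer
  exists and is unique, so the choice in \<open>arg_min\<close> is immaterial.\<close>

definition prox :: "real \<Rightarrow> ('a::real_inner \<Rightarrow> ereal) \<Rightarrow> 'a \<Rightarrow> 'a" where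
  "prox \<gamma> g z = arg_min (\<lambda>x. ereal \<gamma> * g x + ereal ((norm (x - z))\<^sup>2 / 2)) (\<lambda>_. True)"

definition weakly_converges :: "(nat \<Rightarrow> 'a::real_normed_vector) \<Rightarrow> 'a \<Rightarrow> bool" where
  "weakly_converges X l \<longleftrightarrow>
     (\<forall>\<phi> :: 'a \<Rightarrow> real. bounded_linear \<phi> \<longrightarrow> (\<lambda>n. \<phi> (X n)) \<longlonglongrightarrow> \<phi> l)"

end

theory Submission
  imports Defs
begin

text \<open>Put \<open>p\<^sub>k = (z\<^sub>k - x\<^sub>k) / \<gamma>\<^sub>k\<close>. The optimality condition of the proximal step says that \<open>p\<^sub>k\<close> is a
subgradient of \<open>g\<close> at \<open>x\<^sub>k\<close>, and eliminating \<open>z\<^sub>k\<close> and \<open>\<gamma>\<^sub>k\<close> in favour of \<open>p\<^sub>k\<close> gives the recursion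

\<open>y\<^sub>k\<^sub>+\<^sub>1 = x\<^sub>k - s \<nabla>f(x\<^sub>k)\<close>,

\<open>t\<^sub>k\<^sub>+\<^sub>1 x\<^sub>k\<^sub>+\<^sub>1 = (t\<^sub>k\<^sub>+\<^sub>1 + t\<^sub>k - 1) (y\<^sub>k\<^sub>+\<^sub>1 - s p\<^sub>k\<^sub>+\<^sub>1) - (t\<^sub>k - 1) (y\<^sub>k - s p\<^sub>k)\<close>.

All minimizers of \<open>F\<close> share one gradient \<open>D\<close> of \<open>f\<close>, and \<open>-D\<close> is a subgradient of \<open>g\<close> at each of them.
Moving the affine function that is tangent to \<open>f\<close> at a minimizer from \<open>f\<close> to \<open>g\<close>
leaves \<open>F\<close> unchanged, shifts the \<open>y\<^sub>k\<close> by a constant vector and keeps the recursion; afterwards every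
minimizer of \<open>F\<close> minimizes both summands, and both minimal values can be taken to be \<open>0\<close>. In these centred quantities write
\<open>q\<^sub>k\<close> for the gradient of \<open>f\<close> at \<open>x\<^sub>k\<close>. Since \<open>f\<close> is convex with a \<open>1/s\<close>-Lipschitz gradient, it is the Moreau envelope of
a convex function \<open>\<phi>\<close>, with \<open>y\<^sub>k\<^sub>+\<^sub>1\<close> the proximal point of \<open>x\<^sub>k\<close>, with subgradient \<open>q\<^sub>k\<close> of \<open>\<phi>\<close> at \<open>y\<^sub>k\<^sub>+\<^sub>1\<close> and with
\<open>\<phi>(y\<^sub>k\<^sub>+\<^sub>1) = f(x\<^sub>k) - (s/2) \<parallel>q\<^sub>k\<parallel>\<^sup>2\<close>. So the scheme alternates proximal steps on \<open>\<phi>\<close> and on \<open>g\<close>, with momentum.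

The heart of the proof is that, for every minimizer \<open>c\<close>, the energy

\<open>\<parallel>x\<^sub>k + (t\<^sub>k - 1) (x\<^sub>k - y\<^sub>k) - c\<parallel>\<^sup>2 / (2 s) + (t\<^sub>k - 1) \<langle>p\<^sub>k, x\<^sub>k - c\<rangle> + (t\<^sub>k\<^sup>2 - m t\<^sub>k) \<phi>(y\<^sub>k) + (t\<^sub>k\<^sup>2 - t\<^sub>k + 1) g(x\<^sub>k)\<close>

has nonnegative terms and decreases in each step by at least a sum of squares (\<open>energy_step\<close>).
The decrease forces \<open>q\<^sub>k\<close> and \<open>p\<^sub>k\<close> to \<open>0\<close> in norm, the growth of \<open>t\<^sub>k\<close> forces the function
values to \<open>0\<close>, and the first term keeps \<open>x\<^sub>k\<close> bounded. For two minimizers \<open>c\<close> and \<open>d\<close> the energies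
differ, up to a constant, by a multiple of \<open>\<langle>u\<^sub>k, c - d\<rangle>\<close>, where \<open>u\<^sub>k\<^sub>+\<^sub>1 = t\<^sub>k w\<^sub>k\<^sub>+\<^sub>1 - (t\<^sub>k - 1) w\<^sub>k\<close> and \<open>w\<^sub>k = y\<^sub>k - s p\<^sub>k\<close>.
Hence \<open>\<langle>u\<^sub>k, c - d\<rangle>\<close> converges; \<open>w\<^sub>k\<close> is a running average of the \<open>u\<^sub>k\<close> whose weights \<open>1/t\<^sub>k\<close> have a
divergent sum, so \<open>\<langle>w\<^sub>k, c - d\<rangle>\<close> and with it \<open>\<langle>x\<^sub>k, c - d\<rangle>\<close> converges as well (\<open>inner_x_convergent\<close>).

Weak convergence of \<open>x\<^sub>k\<close> then follows as in Opial's lemma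
(\<open>weakly_convergent_if_inner_convergent\<close>), with the closed convex sublevel sets of \<open>F\<close> locating
the limit among the minimizers. Weak compactness enters only in the form that nested nonempty closed bounded
convex sets have a common point. The limits of \<open>y\<^sub>k\<close> and \<open>z\<^sub>k = x\<^sub>k + \<gamma>\<^sub>k p\<^sub>k\<close>
follow because the gradients and subgradients converge in norm and \<open>\<gamma>\<^sub>k\<close> tends to \<open>2 s\<close>.\<close>

section \<open>Hilbert space geometry and weak convergence\<close>

lemma parallelogram_midpoint:
  fixes a b :: "'a::real_inner"
  shows "(norm (a - b))\<^sup>2 = 2 * (norm a)\<^sup>2 + 2 * (norm b)\<^sup>2 - 4 * (norm ((1/2) *\<^sub>R a + (1/2) *\<^sub>R b))\<^sup>2"
  by (simp add: power2_norm_eq_inner inner_simps inner_commute algebra_simps)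

text \<open>This replaces weak compactness of balls. Almost norm-minimal points \<open>a n \<in> C n\<close> form a Cauchy
sequence: the midpoint of two late ones lies in an earlier set, so its norm is almost as large as
theirs, and the parallelogram identity forces them together.\<close>

lemma nested_closed_convex_Inter_nonempty:
  fixes C :: "nat \<Rightarrow> 'a::{real_inner, complete_space} set"
  assumes closed: "\<And>n. closed (C n)" and convex: "\<And>n. convex (C n)" and ne: "\<And>n. C n \<noteq> {}"
    and dec: "decseq C" and bdd: "bounded (C 0)"
  shows "(\<Inter>n. C n) \<noteq> {}"
proof -
  define d where "d n = Inf (norm ` C n)" for n
  have d_le: "d n \<le> norm a" if "a \<in> C n" for n a
    unfolding d_def using that by (intro cInf_lower bdd_belowI2[where m = 0]) auto
  have "\<exists>a\<in>C n. norm a < d n + inverse (real (Suc n))" for n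
    using cInf_lessD[of "norm ` C n" "d n + inverse (real (Suc n))"] ne[of n]
    unfolding d_def by fastforce
  then obtain a where a: "\<And>n. a n \<in> C n" and a_less: "\<And>n. norm (a n) < d n + inverse (real (Suc n))"
    by metis
  have a_in: "a n \<in> C k" if "k \<le> n" for n k
    using a[of n] decseqD[OF dec that] by blast
  obtain B where B: "\<And>u. u \<in> C 0 \<Longrightarrow> norm u \<le> B"
    using bdd by (auto simp: bounded_iff)
  have d_mono: "d k \<le> d n" if "k \<le> n" for k n
    unfolding d_def using ne decseqD[OF dec that]
    by (intro cInf_superset_mono bdd_belowI2[where m = 0]) auto
  have d_bdd: "d n \<le> B" for n
    using d_le[OF a] B[OF a_in[of 0 n]] by (meson le0 order_trans)
  obtain D where D: "d \<longlonglongrightarrow> D" "\<And>n. d n \<le> D"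
    using incseq_convergent[of d B] d_mono d_bdd by (auto simp: incseq_def)
  have d0: "0 \<le> d n" for n
    unfolding d_def using ne by (intro cInf_greatest) auto
  define e where "e n = 4 * ((D + inverse (real (Suc n)))\<^sup>2 - (d n)\<^sup>2)" for n
  have e_lim: "e \<longlonglongrightarrow> 4 * ((D + 0)\<^sup>2 - D\<^sup>2)"
    unfolding e_def by (intro tendsto_intros D LIMSEQ_inverse_real_of_nat)
  have close: "(norm (a i - a j))\<^sup>2 \<le> e n" if "n \<le> i" "n \<le> j" for i j n
  proof -
    have "norm (a k) \<le> D + inverse (real (Suc n))" if "n \<le> k" for k
      using a_less[of k] D(2)[of k] that
      by (smt (verit, best) inverse_Suc le_imp_inverse_le of_nat_0_less_iff of_nat_mono Suc_le_mono zero_less_Suc)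
    then have "(norm (a i))\<^sup>2 \<le> (D + inverse (real (Suc n)))\<^sup>2"
      "(norm (a j))\<^sup>2 \<le> (D + inverse (real (Suc n)))\<^sup>2"
      using that by (auto intro!: power_mono)
    moreover have "(1/2) *\<^sub>R a i + (1/2) *\<^sub>R a j \<in> C n"
      using convex[of n] a_in that by (intro convexD) auto
    then have "(d n)\<^sup>2 \<le> (norm ((1/2) *\<^sub>R a i + (1/2) *\<^sub>R a j))\<^sup>2"
      using d_le d0 by (intro power_mono) auto
    ultimately show ?thesis
      unfolding parallelogram_midpoint e_def by argo
  qed
  have "Cauchy a"
  proof (rule metric_CauchyI)
    fix \<epsilon> :: real assume "\<epsilon> > 0"
    then have "\<forall>\<^sub>F n in sequentially. e n < \<epsilon>\<^sup>2"
      using e_lim by (intro order_tendstoD(2)[where y = 0]) auto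
    then obtain n where n: "e n < \<epsilon>\<^sup>2"
      by (auto simp: eventually_sequentially)
    have "dist (a i) (a j) < \<epsilon>" if "n \<le> i" "n \<le> j" for i j
      using close[OF that] n \<open>\<epsilon> > 0\<close> unfolding dist_norm
      by (meson less_eq_real_def order_le_less_trans power2_less_imp_less)
    then show "\<exists>M. \<forall>i\<ge>M. \<forall>j\<ge>M. dist (a i) (a j) < \<epsilon>"
      by blast
  qed
  then obtain l where l: "a \<longlonglongrightarrow> l"
    using Cauchy_convergent convergent_def by blast
  have "l \<in> C n" for n
    using closed[of n] l a_in
    by (intro Lim_in_closed_set[of "C n" a sequentially]) (auto simp: eventually_sequentially)
  then show ?thesis by blast
qed

lemma nearest_to_origin_exists:
  fixes S :: "'a::{real_inner, complete_space} set"
  assumes "closed S" "convex S" "S \<noteq> {}"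
  shows "\<exists>v\<in>S. \<forall>u\<in>S. norm v \<le> norm u"
proof -
  define d where "d = Inf (norm ` S)"
  define C where "C n = S \<inter> cball 0 (d + inverse (real (Suc n)))" for n
  have d_le: "d \<le> norm u" if "u \<in> S" for u
    unfolding d_def using that by (intro cInf_lower bdd_belowI2[where m = 0]) auto
  have "C n \<noteq> {}" for n
    using cInf_lessD[of "norm ` S" "d + inverse (real (Suc n))"] assms(3)
    unfolding d_def C_def by fastforce
  moreover have "decseq C"
  proof (intro decseq_SucI)
    fix n
    have "inverse (real (Suc (Suc n))) \<le> inverse (real (Suc n))"
      by (intro le_imp_inverse_le) auto
    then have "cball (0::'a) (d + inverse (real (Suc (Suc n)))) \<subseteq> cball 0 (d + inverse (real (Suc n)))"
      by (intro subset_cball) auto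
    then show "C (Suc n) \<le> C n"
      unfolding C_def by blast
  qed
  moreover have "closed (C n)" "convex (C n)" "bounded (C n)" for n
    unfolding C_def using assms by (auto intro: convex_Int bounded_Int)
  ultimately have "(\<Inter>n. C n) \<noteq> {}"
    by (intro nested_closed_convex_Inter_nonempty)
  then obtain v where v: "\<And>n. v \<in> C n" by blast
  have "norm v \<le> d"
  proof (rule LIMSEQ_le_const)
    show "(\<lambda>n. d + inverse (real (Suc n))) \<longlonglongrightarrow> d"
      using tendsto_add[OF tendsto_const LIMSEQ_inverse_real_of_nat, of d] by simp
  qed (use v in \<open>auto simp: C_def\<close>)
  then show ?thesis
    using v d_le by (metis C_def IntD1 order_trans)
qed

text \<open>The point \<open>v\<close> of least norm in the hyperplane where \<open>\<phi>\<close> equals \<open>1\<close> is orthogonal to the kernel of \<open>\<phi>\<close>, so \<open>\<phi>\<close>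
is the inner product with a multiple of \<open>v\<close>.\<close>

lemma riesz_representation:
  fixes \<phi> :: "'a::{real_inner, complete_space} \<Rightarrow> real"
  assumes "bounded_linear \<phi>"
  shows "\<exists>v. \<forall>h. \<phi> h = inner h v"
proof (cases "\<forall>h. \<phi> h = 0")
  case True
  then show ?thesis by (intro exI[of _ 0]) simp
next
  case False
  interpret bounded_linear \<phi> by fact
  obtain h0 where h0: "\<phi> h0 \<noteq> 0" using False by blast
  define S where "S = \<phi> -` {1}"
  have "closed S"
    unfolding S_def by (intro closed_vimage continuous_on_id) (auto intro: continuous_on)
  moreover have "convex S"
    unfolding S_def by (auto simp: convex_def add scaleR)
  moreover have "(1 / \<phi> h0) *\<^sub>R h0 \<in> S"
    using h0 by (simp add: S_def scaleR)
  ultimately obtain v where v: "v \<in> S" "\<And>u. u \<in> S \<Longrightarrow> norm v \<le> norm u"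
    using nearest_to_origin_exists[of S] by blast
  have \<phi>v: "\<phi> v = 1" using v by (simp add: S_def)
  have orth: "inner h v = 0" if "\<phi> h = 0" for h
  proof -
    \<comment> \<open>\<open>v - c h\<close> is the projection of \<open>v\<close> orthogonally to \<open>h\<close>; it is strictly shorter than \<open>v\<close> unless \<open>\<langle>h, v\<rangle> = 0\<close>.\<close>
    define c where "c = inner h v / inner h h"
    have "v - c *\<^sub>R h \<in> S"
      using that \<phi>v by (simp add: S_def diff scaleR)
    then have "(norm v)\<^sup>2 \<le> (norm (v - c *\<^sub>R h))\<^sup>2"
      using v by (simp add: power_mono)
    then have "2 * c * inner h v \<le> c * c * inner h h"
      unfolding power2_norm_eq_inner by (simp add: inner_simps inner_commute algebra_simps)
    then show ?thesis
      unfolding c_def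
      by (cases "inner h h = 0") (auto simp: field_simps mult_le_0_iff zero_le_mult_iff)
  qed
  have "v \<noteq> 0" using \<phi>v zero by force
  have "\<phi> h = inner h ((1 / inner v v) *\<^sub>R v)" for h
  proof -
    have "inner (h - \<phi> h *\<^sub>R v) v = 0"
      using \<phi>v by (intro orth) (simp add: diff scaleR)
    then show ?thesis using \<open>v \<noteq> 0\<close> by (simp add: inner_simps field_simps)
  qed
  then show ?thesis by blast
qed

lemma GDERIV_gradient:
  fixes f :: "'a::{real_inner, complete_space} \<Rightarrow> real"
  assumes "f differentiable (at x)"
  shows "GDERIV f x :> gradient f x"
proof -
  obtain f' where f': "(f has_derivative f') (at x)"
    using assms by (auto simp: differentiable_def)
  obtain v where "\<forall>h. f' h = inner h v"
    using riesz_representation[of f'] has_derivative_bounded_linear[OF f'] by blast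
  then have "f' = (\<lambda>h. inner h v)" by auto
  then have v: "GDERIV f x :> v"
    using f' by (simp add: gderiv_def)
  have "D = v" if "GDERIV f x :> D" for D
  proof -
    have "(\<lambda>h. inner h D) = (\<lambda>h. inner h v)"
      using that v unfolding gderiv_def by (rule has_derivative_unique)
    then show ?thesis
      by (metis inner_diff_right inner_eq_zero_iff right_minus_eq)
  qed
  then show ?thesis
    unfolding gradient_def using v by (metis (mono_tags, lifting) theI)
qed

text \<open>A variant of Opial's lemma. The role of weak cluster points along a subsequence \<open>\<rho>\<close> is played by the
points common to the closed convex hulls of all tails; these lie in every closed convex set that eventually
contains the sequence, hence in the intersection of the \<open>C j\<close>. If \<open>u\<close> and \<open>l\<close> are two such points,
the limit of \<open>\<langle>X k, u - l\<rangle>\<close> is attained by both \<open>\<langle>u, u - l\<rangle>\<close> and \<open>\<langle>l, u - l\<rangle>\<close>, so \<open>u = l\<close>. A functional that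
failed to converge to its value at \<open>l\<close> would confine a subsequence to a closed half-space without \<open>l\<close>, and thereby
produce a second point.\<close>

lemma weakly_convergent_if_inner_convergent:
  fixes X :: "nat \<Rightarrow> 'a::{real_inner, complete_space}" and C :: "nat \<Rightarrow> 'a set"
  assumes bdd: "bounded (range X)"
    and closed: "\<And>j. closed (C j)" and convex: "\<And>j. convex (C j)"
    and ev: "\<And>j. \<forall>\<^sub>F k in sequentially. X k \<in> C j"
    and inner: "\<And>a b. a \<in> (\<Inter>j. C j) \<Longrightarrow> b \<in> (\<Inter>j. C j) \<Longrightarrow> convergent (\<lambda>k. inner (X k) (a - b))"
  shows "\<exists>l\<in>(\<Inter>j. C j). weakly_converges X l"
proof -
  \<comment> \<open>\<open>K \<rho> n\<close> is the closed convex hull of the tail from index \<open>n\<close> of the subsequence \<open>\<rho>\<close>.\<close>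
  define K where "K \<rho> n = closure (convex hull ((\<lambda>k. X (\<rho> k)) ` {n..}))" for \<rho> :: "nat \<Rightarrow> nat" and n
  have K_ne: "(\<Inter>n. K \<rho> n) \<noteq> {}" for \<rho>
  proof (rule nested_closed_convex_Inter_nonempty)
    show "decseq (K \<rho>)"
      unfolding K_def by (intro decseq_SucI closure_mono hull_mono) auto
    show "bounded (K \<rho> 0)"
      unfolding K_def using bdd
      by (intro bounded_closure bounded_convex_hull) (auto intro: bounded_subset)
  qed (auto simp: K_def convex_closure)
  have K_sub: "u \<in> D" if u: "\<And>n. u \<in> K \<rho> n" and D: "closed D" "convex D"
    and ev_D: "\<forall>\<^sub>F k in sequentially. X (\<rho> k) \<in> D" for \<rho> u D
  proof -
    obtain n where "\<And>k. k \<ge> n \<Longrightarrow> X (\<rho> k) \<in> D"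
      using ev_D by (auto simp: eventually_sequentially)
    then have "K \<rho> n \<subseteq> D"
      unfolding K_def using D by (intro closure_minimal hull_minimal) auto
    then show ?thesis using u by blast
  qed
  have K_C: "u \<in> (\<Inter>j. C j)" if "\<And>n. u \<in> K \<rho> n" "strict_mono \<rho>" for u \<rho>
    using K_sub[OF that(1) closed convex] eventually_subseq[OF that(2) ev] by blast
  obtain l where l: "\<And>n. l \<in> K id n"
    using K_ne[of id] by blast
  have l_C: "l \<in> (\<Inter>j. C j)"
    using l by (intro K_C[of l id]) (auto simp: strict_mono_id)
  have unique: "u = l" if u: "\<And>n. u \<in> K \<rho> n" and \<rho>: "strict_mono \<rho>" for u \<rho>
  proof -
    have "u \<in> (\<Inter>j. C j)" using K_C u \<rho> by blast
    then obtain c where c: "(\<lambda>k. inner (X k) (u - l)) \<longlonglongrightarrow> c"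
      using inner l_C unfolding convergent_def by blast
    have *: "inner v (u - l) = c" if v: "\<And>n. v \<in> K \<sigma> n" and \<sigma>: "strict_mono \<sigma>" for v \<sigma>
    proof -
      have lim: "(\<lambda>k. inner (X (\<sigma> k)) (u - l)) \<longlonglongrightarrow> c"
        using LIMSEQ_subseq_LIMSEQ[OF c \<sigma>] by (simp add: o_def)
      have "\<bar>inner v (u - l) - c\<bar> \<le> \<epsilon>" if "\<epsilon> > 0" for \<epsilon>
      proof -
        have "v \<in> {w. inner (u - l) w \<le> c + \<epsilon>} \<inter> {w. inner (u - l) w \<ge> c - \<epsilon>}"
        proof (rule K_sub[OF v])
          have "\<forall>\<^sub>F k in sequentially. dist (inner (X (\<sigma> k)) (u - l)) c < \<epsilon>"
            using lim that by (rule tendstoD)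
          then show "\<forall>\<^sub>F k in sequentially. X (\<sigma> k) \<in> {w. inner (u - l) w \<le> c + \<epsilon>} \<inter> {w. inner (u - l) w \<ge> c - \<epsilon>}"
            by eventually_elim (auto simp: dist_real_def inner_commute abs_less_iff)
        qed (auto intro!: closed_Int closed_halfspace_le closed_halfspace_ge convex_Int
             convex_halfspace_le convex_halfspace_ge)
        then show ?thesis by (auto simp: inner_commute abs_le_iff)
      qed
      then show ?thesis
        by (metis abs_ge_zero abs_le_zero_iff dense_ge eq_iff_diff_eq_0)
    qed
    have "inner (u - l) (u - l) = 0"
      using *[OF u \<rho>] *[OF l strict_mono_id] by (simp add: inner_diff_left)
    then show ?thesis by simp
  qed
  have "weakly_converges X l"
    unfolding weakly_converges_def
  proof (intro allI impI)
    fix \<phi> :: "'a \<Rightarrow> real" assume \<phi>: "bounded_linear \<phi>"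
    interpret bounded_linear \<phi> by fact
    have cont: "continuous_on UNIV \<phi>" by (intro continuous_on continuous_on_id)
    show "(\<lambda>n. \<phi> (X n)) \<longlonglongrightarrow> \<phi> l"
    proof (rule ccontr)
      assume "\<not> ?thesis"
      then obtain \<epsilon> where \<epsilon>: "\<epsilon> > 0" "\<exists>\<^sub>F n in sequentially. \<epsilon> \<le> dist (\<phi> (X n)) (\<phi> l)"
        unfolding tendsto_iff frequently_def by (auto simp: not_le)
      \<comment> \<open>The sign \<open>\<sigma>\<close> records on which side \<open>\<phi> (X n)\<close> stays away from \<open>\<phi> l\<close>, so that the exceptional set is a half-space.\<close>
      define P where "P \<sigma> n \<longleftrightarrow> \<epsilon> \<le> \<sigma> * (\<phi> (X n) - \<phi> l)" for \<sigma> n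
      have "\<exists>\<^sub>F n in sequentially. P 1 n \<or> P (-1) n"
        using \<epsilon>(2) by (rule frequently_elim1) (auto simp: P_def dist_real_def)
      then obtain \<sigma> where \<sigma>: "\<exists>\<^sub>F n in sequentially. P \<sigma> n"
        unfolding frequently_disj_iff by blast
      then have inf: "infinite {n. P \<sigma> n}"
        by (simp add: frequently_cofinite cofinite_eq_sequentially[symmetric])
      define \<rho> where "\<rho> = enumerate {n. P \<sigma> n}"
      have \<rho>: "strict_mono \<rho>" "\<And>n. P \<sigma> (\<rho> n)"
        using strict_mono_enumerate[OF inf] enumerate_in_set[OF inf] by (auto simp: \<rho>_def)
      obtain u where u: "\<And>n. u \<in> K \<rho> n"
        using K_ne[of \<rho>] by blast
      have "u \<in> {v. \<epsilon> \<le> \<sigma> * (\<phi> v - \<phi> l)}"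
      proof (rule K_sub[OF u])
        show "closed {v. \<epsilon> \<le> \<sigma> * (\<phi> v - \<phi> l)}"
          by (intro closed_Collect_le continuous_intros cont)
        have "{v. \<epsilon> \<le> \<sigma> * (\<phi> v - \<phi> l)} = (\<lambda>v. \<sigma> * \<phi> v) -` {\<epsilon> + \<sigma> * \<phi> l..}"
          by (auto simp: algebra_simps)
        moreover have "linear (\<lambda>v. \<sigma> * \<phi> v)"
          by (intro linearI) (auto simp: add scaleR algebra_simps)
        ultimately show "convex {v. \<epsilon> \<le> \<sigma> * (\<phi> v - \<phi> l)}"
          by (simp add: convex_linear_vimage)
      qed (use \<rho>(2) in \<open>auto simp: P_def\<close>)
      then show False
        using unique[OF u \<rho>(1)] \<epsilon>(1) by auto
    qed
  qed
  then show ?thesis using l_C by blast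
qed

section \<open>Smooth convex functions, subgradients and proximal points\<close>

lemma has_real_derivative_along_line:
  assumes "GDERIV f (a + \<tau> *\<^sub>R d) :> D"
  shows "((\<lambda>\<tau>. f (a + \<tau> *\<^sub>R d)) has_real_derivative inner D d) (at \<tau>)"
proof -
  have "((\<lambda>\<tau>. a + \<tau> *\<^sub>R d) has_derivative (\<lambda>h. h *\<^sub>R d)) (at \<tau>)"
    by (auto intro!: derivative_eq_intros)
  moreover have "(f has_derivative (\<lambda>h. inner h D)) (at (a + \<tau> *\<^sub>R d))"
    using assms by (simp add: gderiv_def)
  ultimately have "((\<lambda>\<tau>. f (a + \<tau> *\<^sub>R d)) has_derivative (\<lambda>h. inner (h *\<^sub>R d) D)) (at \<tau>)"
    by (rule has_derivative_compose)
  moreover have "(\<lambda>h. inner (h *\<^sub>R d) D) = (*) (inner D d)"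
    by (auto simp: inner_commute)
  ultimately show ?thesis
    by (simp add: has_field_derivative_def)
qed

lemma tangent_below_convex:
  assumes "convex_on UNIV f" "GDERIV f a :> D"
  shows "f a + inner D (b - a) \<le> f b"
proof -
  define \<psi> where "\<psi> \<tau> = f (a + \<tau> *\<^sub>R (b - a))" for \<tau>
  have "convex_on UNIV \<psi>"
    unfolding convex_on_def
  proof (intro conjI allI ballI impI)
    fix x y u v :: real assume uv: "0 \<le> u" "0 \<le> v" "u + v = 1"
    have "a + (u * x + v * y) *\<^sub>R (b - a) = (u + v) *\<^sub>R a + (u * x + v * y) *\<^sub>R (b - a)"
      using uv by simp
    also have "\<dots> = u *\<^sub>R (a + x *\<^sub>R (b - a)) + v *\<^sub>R (a + y *\<^sub>R (b - a))"
      by (simp add: algebra_simps)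
    finally show "\<psi> (u *\<^sub>R x + v *\<^sub>R y) \<le> u * \<psi> x + v * \<psi> y"
      using assms(1) uv unfolding \<psi>_def convex_on_def by simp
  qed auto
  moreover have "(\<psi> has_real_derivative inner D (b - a)) (at 0)"
    unfolding \<psi>_def using assms(2) by (intro has_real_derivative_along_line) simp
  ultimately have "inner D (b - a) * (1 - 0) \<le> \<psi> 1 - \<psi> 0"
    by (intro convex_on_imp_above_tangent[of UNIV]) auto
  then show ?thesis by (simp add: \<psi>_def)
qed

lemma quadratic_upper_bound:
  fixes D :: "'a::real_inner \<Rightarrow> 'a"
  assumes D: "\<And>x. GDERIV f x :> D x" and lip: "\<And>u v. norm (D u - D v) \<le> L * norm (u - v)"
  shows "f b \<le> f a + inner (D a) (b - a) + L / 2 * (norm (b - a))\<^sup>2"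
proof -
  define d where "d = b - a"
  define \<psi> where "\<psi> \<tau> = f (a + \<tau> *\<^sub>R d) - \<tau> * inner (D a) d - L / 2 * \<tau>\<^sup>2 * (norm d)\<^sup>2" for \<tau>
  have "\<psi> 1 \<le> \<psi> 0"
  proof (rule DERIV_nonpos_imp_nonincreasing[of 0 1 \<psi>])
    fix \<tau> :: real assume \<tau>: "0 \<le> \<tau>" "\<tau> \<le> 1"
    have "inner (D (a + \<tau> *\<^sub>R d) - D a) d \<le> norm (D (a + \<tau> *\<^sub>R d) - D a) * norm d"
      by (rule norm_cauchy_schwarz)
    also have "\<dots> \<le> (L * norm (\<tau> *\<^sub>R d)) * norm d"
      using lip[of "a + \<tau> *\<^sub>R d" a] by (intro mult_right_mono) auto
    finally have "inner (D (a + \<tau> *\<^sub>R d)) d - inner (D a) d - L * \<tau> * (norm d)\<^sup>2 \<le> 0"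
      using \<tau> by (simp add: inner_diff_left power2_eq_square)
    moreover have "(\<psi> has_real_derivative inner (D (a + \<tau> *\<^sub>R d)) d - inner (D a) d - L * \<tau> * (norm d)\<^sup>2) (at \<tau>)"
      unfolding \<psi>_def by (auto intro!: derivative_eq_intros has_real_derivative_along_line[OF D])
    ultimately show "\<exists>y. (\<psi> has_real_derivative y) (at \<tau>) \<and> y \<le> 0" by blast
  qed simp
  then show ?thesis by (simp add: \<psi>_def d_def)
qed

text \<open>The Baillon--Haddad inequality. The convex function \<open>f - \<langle>D v, \<cdot>\<rangle>\<close> is minimal at \<open>v\<close>, so its value there is
at most its value after one gradient step of length \<open>s\<close> from \<open>u\<close>, and the quadratic upper bound
says how much such a step gains.\<close>

lemma gradient_cocoercive:
  fixes D :: "'a::real_inner \<Rightarrow> 'a"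
  assumes convex: "convex_on UNIV f" and D: "\<And>x. GDERIV f x :> D x"
    and s: "s > 0" and lip: "\<And>u v. norm (D u - D v) \<le> 1 / s * norm (u - v)"
  shows "f v + inner (D v) (u - v) + s / 2 * (norm (D u - D v))\<^sup>2 \<le> f u"
proof -
  define e where "e = D u - D v"
  define w where "w = u - s *\<^sub>R e"
  have "f v + inner (D v) (w - v) \<le> f w"
    by (rule tangent_below_convex[OF convex D])
  also have "f w \<le> f u + inner (D u) (w - u) + (1 / s) / 2 * (norm (w - u))\<^sup>2"
    by (rule quadratic_upper_bound[OF D lip])
  finally have *: "f v + inner (D v) (w - v) \<le> f u + inner (D u) (w - u) + (1 / s) / 2 * (norm (w - u))\<^sup>2" .
  have "f v + inner (D v) (w - v) \<le> f u - s * inner (D u) e + s / 2 * inner e e"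
  proof -
    have "inner (D u) (w - u) = - (s * inner (D u) e)" "(norm (w - u))\<^sup>2 = s * s * inner e e"
      unfolding power2_norm_eq_inner by (simp_all add: w_def)
    then show ?thesis using * s by simp
  qed
  moreover have "inner (D v) (w - v) = inner (D v) (u - v) - s * inner (D v) e"
    by (simp add: w_def inner_diff_right)
  moreover have "inner (D u) e - inner (D v) e = inner e e"
    by (simp add: e_def inner_diff_left)
  then have "s * inner (D u) e - s * inner (D v) e = s * inner e e"
    by (metis right_diff_distrib)
  ultimately show ?thesis
    unfolding e_def[symmetric] power2_norm_eq_inner by simp
qed

text \<open>First-order optimality for a sum. Along the segment from \<open>a\<close> to \<open>v\<close> the convex part grows at most
linearly while \<open>f\<close> deviates from its linearization by \<open>O(\<tau>\<^sup>2)\<close>; dividing by \<open>\<tau>\<close> and letting \<open>\<tau>\<close> tend to \<open>0\<close>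
leaves the subgradient inequality. With \<open>f\<close> smooth this gives the optimality condition for \<open>F\<close>,
and with \<open>f\<close> a multiple of a squared distance that of a proximal point.\<close>

lemma minimizer_imp_subgradient:
  fixes f G :: "'a::real_inner \<Rightarrow> real"
  assumes G: "convex_on S G" and a: "a \<in> S" and min: "\<And>v. v \<in> S \<Longrightarrow> f a + G a \<le> f v + G v"
    and upper: "\<And>v. f v \<le> f a + inner D (v - a) + C * (norm (v - a))\<^sup>2"
    and v: "v \<in> S"
  shows "G a - inner D (v - a) \<le> G v"
proof -
  have "G a - inner D (v - a) - G v \<le> \<tau> * (C * (norm (v - a))\<^sup>2)" if \<tau>: "0 < \<tau>" "\<tau> \<le> 1" for \<tau>
  proof -
    define w where "w = (1 - \<tau>) *\<^sub>R a + \<tau> *\<^sub>R v"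
    have w: "w \<in> S" "G w \<le> (1 - \<tau>) * G a + \<tau> * G v"
      using G a v \<tau> unfolding w_def convex_on_def convex_def by auto
    have "w - a = \<tau> *\<^sub>R (v - a)" by (simp add: w_def algebra_simps)
    then have "f w \<le> f a + \<tau> * inner D (v - a) + C * (\<tau> * norm (v - a))\<^sup>2"
      using upper[of w] \<tau> by simp
    with w min[OF w(1)] have "\<tau> * (G a - inner D (v - a) - G v) \<le> \<tau> * (\<tau> * (C * (norm (v - a))\<^sup>2))"
      by (simp add: power2_eq_square algebra_simps)
    then show ?thesis using \<tau> by simp
  qed
  then have "\<forall>\<^sub>F \<tau> in at_right 0. G a - inner D (v - a) - G v \<le> \<tau> * (C * (norm (v - a))\<^sup>2)"
    by (intro eventually_at_rightI[of 0 1]) auto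
  moreover have "((\<lambda>\<tau>. \<tau> * (C * (norm (v - a))\<^sup>2)) \<longlongrightarrow> 0 * (C * (norm (v - a))\<^sup>2)) (at_right 0)"
    by (intro tendsto_intros)
  ultimately have "G a - inner D (v - a) - G v \<le> 0 * (C * (norm (v - a))\<^sup>2)"
    by (intro tendsto_lowerbound) auto
  then show ?thesis by simp
qed

abbreviation effective_domain :: "('a \<Rightarrow> ereal) \<Rightarrow> 'a set" where
  "effective_domain g \<equiv> {u. g u \<noteq> \<infinity>}"

lemma proper_fun_real: "proper_fun g \<Longrightarrow> u \<in> effective_domain g \<Longrightarrow> g u = ereal (real_of_ereal (g u))"
  by (cases "g u") (auto simp: proper_fun_def)

lemma convex_on_real_of_convex_ereal:
  assumes "proper_fun g" "convex_ereal g"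
  shows "convex_on (effective_domain g) (\<lambda>u. real_of_ereal (g u))"
proof -
  have *: "u *\<^sub>R a + v *\<^sub>R b \<in> effective_domain g \<and>
      real_of_ereal (g (u *\<^sub>R a + v *\<^sub>R b)) \<le> u * real_of_ereal (g a) + v * real_of_ereal (g b)"
    if "a \<in> effective_domain g" "b \<in> effective_domain g" "0 \<le> u" "0 \<le> v" "u + v = 1" for a b u v
  proof -
    have "g (u *\<^sub>R a + v *\<^sub>R b) \<le> ereal u * g a + ereal v * g b"
      using assms(2) that unfolding convex_ereal_def by blast
    also have "\<dots> = ereal (u * real_of_ereal (g a) + v * real_of_ereal (g b))"
      by (subst (1 2) proper_fun_real[OF assms(1)]) (use that in auto)
    finally have le: "g (u *\<^sub>R a + v *\<^sub>R b) \<le> ereal (u * real_of_ereal (g a) + v * real_of_ereal (g b))" .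
    then have d: "u *\<^sub>R a + v *\<^sub>R b \<in> effective_domain g" by auto
    show ?thesis using le d proper_fun_real[OF assms(1) d] by (metis ereal_less_eq(3))
  qed
  show ?thesis
    unfolding convex_on_def convex_def using * by blast
qed

lemma lsc_epigraph_closed:
  fixes g :: "'a::metric_space \<Rightarrow> ereal"
  assumes "lsc g" "u \<longlonglongrightarrow> l" "a \<longlonglongrightarrow> c" "\<And>n. g (u n) \<le> ereal (a n)"
  shows "g l \<le> ereal c"
proof (rule ccontr)
  assume "\<not> ?thesis"
  then have "ereal c < g l" by simp
  then obtain b where b: "c < b" "ereal b < g l"
    using ereal_dense2[of "ereal c" "g l"] by auto
  have "ereal b < Liminf (at l) g"
    using assms(1) b(2) unfolding lsc_def by (meson order_less_le_trans)
  then have "\<forall>\<^sub>F y in nhds l. ereal b < g y"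
    using less_LiminfD b(2) by (simp add: eventually_nhds_conv_at)
  then have "\<forall>\<^sub>F n in sequentially. ereal b < g (u n)"
    using assms(2) by (rule eventually_compose_filterlim)
  moreover have "\<forall>\<^sub>F n in sequentially. a n < b"
    using assms(3) b(1) by (rule order_tendstoD)
  ultimately have "\<forall>\<^sub>F n in sequentially. False"
  proof eventually_elim
    case (elim n)
    then have "ereal b < ereal (a n)" using assms(4)[of n] order_less_le_trans by blast
    then show ?case using elim by simp
  qed
  then show False by simp
qed

lemma lsc_sublevel_closed:
  fixes g :: "'a::metric_space \<Rightarrow> ereal"
  assumes "lsc g" "continuous_on UNIV h"
  shows "closed {u. g u \<le> ereal (h u)}"
  unfolding closed_sequential_limits
proof (intro allI impI, elim conjE)
  fix u l assume u: "\<forall>n. u n \<in> {u. g u \<le> ereal (h u)}" "u \<longlonglongrightarrow> l"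
  have "(\<lambda>n. h (u n)) \<longlonglongrightarrow> h l"
    using continuous_on_tendsto_compose[OF assms(2) u(2)] by simp
  then show "l \<in> {u. g u \<le> ereal (h u)}"
    using lsc_epigraph_closed[OF assms(1) u(2)] u(1) by blast
qed

lemma convex_on_sublevel:
  assumes "convex_on S h"
  shows "convex {u \<in> S. h u \<le> c}"
proof -
  have "h (u *\<^sub>R a + v *\<^sub>R b) \<le> c" if "a \<in> S" "h a \<le> c" "b \<in> S" "h b \<le> c" "0 \<le> u" "0 \<le> v" "u + v = 1" for a b u v
  proof -
    have "h (u *\<^sub>R a + v *\<^sub>R b) \<le> u * h a + v * h b"
      using assms that unfolding convex_on_def by blast
    also have "\<dots> \<le> c" using that by (intro convex_bound_le) auto
    finally show ?thesis .
  qed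
  then show ?thesis
    using assms unfolding convex_on_def convex_def by blast
qed

text \<open>Existence of proximal points. An affine minorant of \<open>g\<close> makes the objective \<open>h\<close> coercive, so its sublevel sets just
above the infimum are nested, nonempty, closed, convex and bounded and have a common point. Taking
the minorant as a hypothesis avoids a separation argument: for the composite problem the
optimality condition at a minimizer of \<open>F\<close> supplies it.\<close>

lemma prox_minimizes:
  fixes g :: "'a::{real_inner, complete_space} \<Rightarrow> ereal" and z v :: 'a
  assumes g: "proper_fun g" "convex_ereal g" "lsc g" and \<gamma>: "\<gamma> > 0"
    and minorant: "\<And>v. v \<in> effective_domain g \<Longrightarrow> c + inner e v \<le> real_of_ereal (g v)"
  defines "h \<equiv> \<lambda>v. real_of_ereal (g v) + (norm (v - z))\<^sup>2 / (2 * \<gamma>)"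
  shows "prox \<gamma> g z \<in> effective_domain g" "v \<in> effective_domain g \<Longrightarrow> h (prox \<gamma> g z) \<le> h v"
proof -
  \<comment> \<open>Completing the square in \<open>c + \<langle>e, v\<rangle> + \<parallel>v - z\<parallel>\<^sup>2 / (2 \<gamma>)\<close> centres it at \<open>z - \<gamma> e\<close> with minimal value \<open>K\<close>.\<close>
  define K where "K = c + inner e z - \<gamma> * inner e e / 2"
  have coercive: "K + (norm (v - (z - \<gamma> *\<^sub>R e)))\<^sup>2 / (2 * \<gamma>) \<le> h v" if "v \<in> effective_domain g" for v
  proof -
    have "K + (norm (v - (z - \<gamma> *\<^sub>R e)))\<^sup>2 / (2 * \<gamma>) = c + inner e v + (norm (v - z))\<^sup>2 / (2 * \<gamma>)"
      unfolding K_def power2_norm_eq_inner using \<gamma>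
      by (simp add: inner_simps inner_commute field_simps)
    then show ?thesis using minorant[OF that] by (simp add: h_def)
  qed
  have K: "K \<le> h v" if "v \<in> effective_domain g" for v
    using coercive[OF that] \<gamma> by (smt (verit) divide_nonneg_pos zero_le_power2)
  obtain v0 where v0: "v0 \<in> effective_domain g" using g(1) by (auto simp: proper_fun_def)
  define I where "I = Inf (h ` effective_domain g)"
  have I_le: "I \<le> h v" if "v \<in> effective_domain g" for v
    unfolding I_def using that K by (intro cInf_lower bdd_belowI2[where m = K]) auto
  define C where "C n = {v \<in> effective_domain g. h v \<le> I + inverse (real (Suc n))}" for n
  have C_eq: "C n = {v. g v \<le> ereal (I + inverse (real (Suc n)) - (norm (v - z))\<^sup>2 / (2 * \<gamma>))}" for n
  proof (intro equalityI subsetI)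
    fix v assume "v \<in> C n"
    then show "v \<in> {v. g v \<le> ereal (I + inverse (real (Suc n)) - (norm (v - z))\<^sup>2 / (2 * \<gamma>))}"
      using proper_fun_real[OF g(1), of v] unfolding C_def h_def
      by (smt (verit, ccfv_SIG) ereal_less_eq(3) mem_Collect_eq)
  next
    fix v assume v: "v \<in> {v. g v \<le> ereal (I + inverse (real (Suc n)) - (norm (v - z))\<^sup>2 / (2 * \<gamma>))}"
    then have "v \<in> effective_domain g" by auto
    then show "v \<in> C n"
      using v proper_fun_real[OF g(1), of v] unfolding C_def h_def
      by (smt (verit, ccfv_SIG) ereal_less_eq(3) mem_Collect_eq)
  qed
  have "convex_on UNIV (\<lambda>v. (norm (v - z))\<^sup>2 / (2 * \<gamma>))"
    unfolding convex_on_def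
  proof (intro conjI ballI allI impI)
    fix a b :: 'a and u v :: real assume uv: "0 \<le> u" "0 \<le> v" "u + v = 1"
    have u: "u = 1 - v" using uv by simp
    have "(norm (u *\<^sub>R a + v *\<^sub>R b - z))\<^sup>2 = u * (norm (a - z))\<^sup>2 + v * (norm (b - z))\<^sup>2 - u * v * (norm (a - b))\<^sup>2"
      unfolding u power2_norm_eq_inner by (simp add: inner_simps inner_commute algebra_simps)
    moreover have "0 \<le> u * v * (norm (a - b))\<^sup>2" using uv by simp
    ultimately have "(norm (u *\<^sub>R a + v *\<^sub>R b - z))\<^sup>2 \<le> u * (norm (a - z))\<^sup>2 + v * (norm (b - z))\<^sup>2"
      by linarith
    then have "(norm (u *\<^sub>R a + v *\<^sub>R b - z))\<^sup>2 / (2 * \<gamma>) \<le> (u * (norm (a - z))\<^sup>2 + v * (norm (b - z))\<^sup>2) / (2 * \<gamma>)"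
      using \<gamma> by (intro divide_right_mono) auto
    then show "(norm (u *\<^sub>R a + v *\<^sub>R b - z))\<^sup>2 / (2 * \<gamma>) \<le> u * ((norm (a - z))\<^sup>2 / (2 * \<gamma>)) + v * ((norm (b - z))\<^sup>2 / (2 * \<gamma>))"
      by (simp add: add_divide_distrib)
  qed auto
  then have h_convex: "convex_on (effective_domain g) h"
    unfolding h_def using convex_on_real_of_convex_ereal[OF g(1,2)]
    by (intro convex_on_add) (auto intro: convex_on_subset simp: convex_on_def)
  have "(\<Inter>n. C n) \<noteq> {}"
  proof (rule nested_closed_convex_Inter_nonempty)
    fix n
    show "closed (C n)"
      unfolding C_eq by (intro lsc_sublevel_closed g(3) continuous_intros) (use \<gamma> in auto)
    show "convex (C n)"
      unfolding C_def by (rule convex_on_sublevel[OF h_convex])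
    show "C n \<noteq> {}"
      using cInf_lessD[of "h ` effective_domain g" "I + inverse (real (Suc n))"] v0
      unfolding I_def C_def by fastforce
  next
    have "inverse (real (Suc (Suc n))) \<le> inverse (real (Suc n))" for n
      by (intro le_imp_inverse_le) auto
    then show "decseq C"
      unfolding C_def by (intro decseq_SucI) (auto intro: order_trans simp del: of_nat_Suc)
  next
    have "norm (v - (z - \<gamma> *\<^sub>R e)) \<le> sqrt (2 * \<gamma> * (I + 1 - K))" if "v \<in> C 0" for v
    proof (rule real_le_rsqrt)
      have "(norm (v - (z - \<gamma> *\<^sub>R e)))\<^sup>2 / (2 * \<gamma>) \<le> I + 1 - K"
        using that coercive[of v] by (auto simp: C_def)
      then show "(norm (v - (z - \<gamma> *\<^sub>R e)))\<^sup>2 \<le> 2 * \<gamma> * (I + 1 - K)"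
        using \<gamma> by (simp add: pos_divide_le_eq mult.commute)
    qed
    then have "C 0 \<subseteq> cball (z - \<gamma> *\<^sub>R e) (sqrt (2 * \<gamma> * (I + 1 - K)))"
      by (auto simp: dist_norm norm_minus_commute)
    then show "bounded (C 0)" using bounded_cball bounded_subset by blast
  qed
  then obtain a where a: "\<And>n. a \<in> C n" by blast
  have a_dom: "a \<in> effective_domain g" using a[of 0] by (simp add: C_def)
  have "h a \<le> I"
  proof (rule LIMSEQ_le_const)
    show "(\<lambda>n. I + inverse (real (Suc n))) \<longlonglongrightarrow> I"
      using tendsto_add[OF tendsto_const LIMSEQ_inverse_real_of_nat, of I] by simp
  qed (use a in \<open>auto simp: C_def\<close>)
  then have a_min: "h a \<le> h v" if "v \<in> effective_domain g" for v
    using I_le[OF that] by simp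
  define H where "H v = ereal \<gamma> * g v + ereal ((norm (v - z))\<^sup>2 / 2)" for v
  have H_dom: "H v = ereal (\<gamma> * h v)" if "v \<in> effective_domain g" for v
    unfolding H_def h_def by (subst proper_fun_real[OF g(1) that]) (use \<gamma> in \<open>simp add: field_simps\<close>)
  have H_inf: "H v = \<infinity>" if "v \<notin> effective_domain g" for v
    using that \<gamma> by (simp add: H_def)
  have "is_arg_min H (\<lambda>_. True) a"
    unfolding is_arg_min_def
  proof (intro conjI notI TrueI)
    assume "\<exists>v. True \<and> H v < H a"
    then obtain v where v: "H v < H a" by blast
    then have "v \<in> effective_domain g" using H_inf[of v] by auto
    then show False using v a_min[of v] \<gamma> by (simp add: H_dom a_dom[simplified])
  qed
  then have "is_arg_min H (\<lambda>_. True) (prox \<gamma> g z)"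
    unfolding prox_def H_def[symmetric] arg_min_def by (rule someI)
  then have le: "H (prox \<gamma> g z) \<le> H v" for v
    by (simp add: is_arg_min_def not_less)
  show dom: "prox \<gamma> g z \<in> effective_domain g"
    using le[of a] H_dom[OF a_dom] H_inf[of "prox \<gamma> g z"] by auto
  show "h (prox \<gamma> g z) \<le> h v" if "v \<in> effective_domain g"
    using le[of v] \<gamma> by (simp add: H_dom[OF dom] H_dom[OF that])
qed

text \<open>The vector \<open>(z - x) / \<gamma>\<close> is minus the gradient at \<open>x\<close> of \<open>v \<mapsto> \<parallel>v - z\<parallel>\<^sup>2 / (2 \<gamma>)\<close>.\<close>

lemma prox_subgradient:
  fixes g :: "'a::{real_inner, complete_space} \<Rightarrow> ereal" and z v :: 'a
  assumes g: "proper_fun g" "convex_ereal g" "lsc g" and \<gamma>: "\<gamma> > 0"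
    and minorant: "\<And>v. v \<in> effective_domain g \<Longrightarrow> c + inner e v \<le> real_of_ereal (g v)"
    and v: "v \<in> effective_domain g"
  defines "x \<equiv> prox \<gamma> g z"
  shows "real_of_ereal (g x) + inner ((1 / \<gamma>) *\<^sub>R (z - x)) (v - x) \<le> real_of_ereal (g v)"
proof -
  define f where "f v = (norm (v - z))\<^sup>2 / (2 * \<gamma>)" for v
  have "real_of_ereal (g x) - inner ((1 / \<gamma>) *\<^sub>R (x - z)) (v - x) \<le> real_of_ereal (g v)"
  proof (rule minimizer_imp_subgradient[where f = f and C = "1 / (2 * \<gamma>)"])
    show "convex_on (effective_domain g) (\<lambda>v. real_of_ereal (g v))"
      using g by (intro convex_on_real_of_convex_ereal)
    show "x \<in> effective_domain g"
      unfolding x_def by (rule prox_minimizes(1)[OF g \<gamma> minorant])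
    show "f x + real_of_ereal (g x) \<le> f w + real_of_ereal (g w)" if "w \<in> effective_domain g" for w
      using prox_minimizes(2)[OF g \<gamma> minorant that, of z] by (simp add: f_def x_def add.commute)
    show "f w \<le> f x + inner ((1 / \<gamma>) *\<^sub>R (x - z)) (w - x) + 1 / (2 * \<gamma>) * (norm (w - x))\<^sup>2" for w
      unfolding f_def power2_norm_eq_inner using \<gamma>
      by (simp add: inner_simps inner_commute field_simps)
  qed (rule v)
  then show ?thesis by (simp add: inner_simps algebra_simps)
qed

lemma weakly_converges_add_tendsto:
  assumes "weakly_converges X l" "a \<longlonglongrightarrow> b"
  shows "weakly_converges (\<lambda>n. X n + a n) (l + b)"
  unfolding weakly_converges_def
proof (intro allI impI)
  fix \<phi> :: "'a \<Rightarrow> real" assume \<phi>: "bounded_linear \<phi>"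
  then have "(\<lambda>n. \<phi> (X n) + \<phi> (a n)) \<longlonglongrightarrow> \<phi> l + \<phi> b"
    using assms(1) unfolding weakly_converges_def
    by (intro tendsto_add bounded_linear.tendsto[OF \<phi> assms(2)]) blast
  then show "(\<lambda>n. \<phi> (X n + a n)) \<longlonglongrightarrow> \<phi> (l + b)"
    using \<phi> by (simp add: bounded_linear.linear linear_add)
qed

section \<open>Two lemmas on real sequences\<close>

lemma contraction_with_vanishing_error:
  fixes a e :: "nat \<Rightarrow> real"
  assumes "\<And>k. 0 \<le> a k" "\<And>k. a (Suc k) \<le> a k / 2 + e k" "e \<longlonglongrightarrow> 0"
  shows "a \<longlonglongrightarrow> 0"
proof (rule LIMSEQ_I)
  fix r :: real assume "r > 0"
  obtain N where N: "\<And>k. k \<ge> N \<Longrightarrow> e k < r / 4"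
    using order_tendstoD(2)[OF assms(3), of "r/4"] \<open>r > 0\<close> by (auto simp: eventually_sequentially)
  have bound: "a (N + j) \<le> a N * (1/2) ^ j + r / 2" for j
  proof (induction j)
    case 0 then show ?case using \<open>r > 0\<close> by simp
  next
    case (Suc j)
    then have "a (N + j) / 2 \<le> (a N * (1/2) ^ j + r / 2) / 2"
      by (rule divide_right_mono) simp
    then have "a (Suc (N + j)) \<le> (a N * (1/2) ^ j + r / 2) / 2 + r / 4"
      using assms(2)[of "N + j"] N[OF le_add1, of j] by (meson add_mono order_trans less_imp_le)
    also have "\<dots> = a N * (1/2) ^ Suc j + r / 2" by (simp add: add_divide_distrib)
    finally show ?case by simp
  qed
  have "(\<lambda>j. a N * (1/2) ^ j + r / 2) \<longlonglongrightarrow> a N * 0 + r / 2"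
    by (intro tendsto_intros LIMSEQ_power_zero) auto
  then have "\<forall>\<^sub>F j in sequentially. a N * (1/2) ^ j + r / 2 < r"
    by (rule order_tendstoD) (use \<open>r > 0\<close> in simp)
  then obtain M where M: "\<And>j. j \<ge> M \<Longrightarrow> a N * (1/2) ^ j + r / 2 < r"
    by (auto simp: eventually_sequentially)
  have "norm (a k - 0) < r" if "k \<ge> N + M" for k
  proof -
    have "M \<le> k - N" using that by arith
    then show ?thesis using bound[of "k - N"] M[of "k - N"] that assms(1)[of k] by auto
  qed
  then show "\<exists>no. \<forall>k\<ge>no. norm (a k - 0) < r" by blast
qed

text \<open>Each \<open>h (Suc k)\<close> is the convex combination of \<open>h k\<close> and \<open>a k\<close> with weights \<open>1 - 1 / t k\<close> and \<open>1 / t k\<close>. Once \<open>a\<close> is small, the influence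
of the past is damped by the product of the \<open>1 - 1 / t k\<close>, which vanishes because \<open>t\<close> grows at most
linearly and the sum of the \<open>1 / t k\<close> therefore diverges.\<close>

lemma weighted_average_tendsto_zero:
  fixes h a t :: "nat \<Rightarrow> real"
  assumes avg: "\<And>k. t k * h (Suc k) = (t k - 1) * h k + a k"
    and t: "\<And>k. 1 \<le> t k" "\<And>k. t k \<le> real (Suc k)" and a: "a \<longlonglongrightarrow> 0"
  shows "h \<longlonglongrightarrow> 0"
proof (rule LIMSEQ_I)
  fix r :: real assume "r > 0"
  obtain N where N: "\<And>k. k \<ge> N \<Longrightarrow> \<bar>a k\<bar> < r / 2"
    using LIMSEQ_D[OF a, of "r/2"] \<open>r > 0\<close> by auto
  define B where "B = \<bar>h N\<bar>"
  define P where "P j = (\<Prod>i<j. 1 - 1 / t (N + i))" for j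
  have bound: "\<bar>h (N + j)\<bar> \<le> B * P j + r / 2" for j
  proof (induction j)
    case 0 then show ?case using \<open>r > 0\<close> by (simp add: B_def P_def)
  next
    case (Suc j)
    define \<tau> where "\<tau> = 1 / t (N + j)"
    have \<tau>: "0 < \<tau>" "\<tau> \<le> 1" using t(1)[of "N + j"] by (auto simp: \<tau>_def)
    have "h (Suc (N + j)) = (1 - \<tau>) * h (N + j) + \<tau> * a (N + j)"
      using avg[of "N + j"] t(1)[of "N + j"] by (simp add: \<tau>_def field_simps)
    then have "\<bar>h (Suc (N + j))\<bar> \<le> (1 - \<tau>) * \<bar>h (N + j)\<bar> + \<tau> * \<bar>a (N + j)\<bar>"
      using \<tau> by (metis abs_mult abs_of_nonneg abs_triangle_ineq diff_ge_0_iff_ge less_imp_le)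
    also have "\<dots> \<le> (1 - \<tau>) * (B * P j + r / 2) + \<tau> * (r / 2)"
      using \<tau> Suc N[of "N + j"] by (intro add_mono mult_left_mono) auto
    also have "\<dots> = B * P (Suc j) + r / 2"
      unfolding P_def \<tau>_def by (simp add: algebra_simps diff_divide_distrib)
    finally show ?case by simp
  qed
  \<comment> \<open>From \<open>t (N + i) \<le> N + i + 1\<close> each factor is at most \<open>(N + i) / (N + i + 1)\<close>, and these telescope.\<close>
  have P0: "0 \<le> P j" for j
    unfolding P_def using t(1) by (intro prod_nonneg) (auto simp: divide_le_eq_1 intro: order_trans[OF zero_le_one])
  have P: "P j \<le> (real N + 1) / real (N + j + 1)" for j
  proof (induction j)
    case 0 then show ?case by (simp add: P_def)
  next
    case (Suc j)
    have "1 / real (N + j + 1) \<le> 1 / t (N + j)"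
      using t[of "N + j"] by (intro divide_left_mono) auto
    then have "1 - 1 / t (N + j) \<le> real (N + j) / real (N + j + 1)"
      by (simp add: field_simps)
    then have "P (Suc j) \<le> P j * (real (N + j) / real (N + j + 1))"
      using mult_left_mono[OF _ P0[of j], of "1 - 1 / t (N + j)"] unfolding P_def prod.lessThan_Suc by blast
    also have "\<dots> \<le> (real N + 1) / real (N + j + 1) * (real (N + j) / real (N + j + 1))"
      using Suc by (intro mult_right_mono) auto
    also have "\<dots> = (real N + 1) * (real (N + j) / (real (N + j + 1))\<^sup>2)"
      by (simp add: power2_eq_square)
    also have "\<dots> \<le> (real N + 1) * (1 / real (N + Suc j + 1))"
    proof -
      have "M / (M + 1)\<^sup>2 \<le> 1 / (M + 2)" if "M \<ge> 0" for M :: real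
        using that by (simp add: divide_simps) (simp add: power2_eq_square algebra_simps)
      from this[of "real (N + j)"] show ?thesis
        by (intro mult_left_mono) (auto simp: add_ac)
    qed
    finally show ?case by simp
  qed
  have "(\<lambda>j. B * ((real N + 1) / real (N + j + 1)) + r / 2) \<longlonglongrightarrow> B * 0 + r / 2"
  proof (intro tendsto_intros)
    have "(\<lambda>j. (real N + 1) * inverse (real (Suc (j + N)))) \<longlonglongrightarrow> (real N + 1) * 0"
      by (intro tendsto_intros LIMSEQ_ignore_initial_segment[OF LIMSEQ_inverse_real_of_nat])
    then show "(\<lambda>j. (real N + 1) / real (N + j + 1)) \<longlonglongrightarrow> 0"
      by (simp add: divide_inverse add_ac)
  qed
  then have "\<forall>\<^sub>F j in sequentially. B * ((real N + 1) / real (N + j + 1)) + r / 2 < r"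
    by (rule order_tendstoD) (use \<open>r > 0\<close> in simp)
  then obtain M where M: "\<And>j. j \<ge> M \<Longrightarrow> B * ((real N + 1) / real (N + j + 1)) + r / 2 < r"
    by (auto simp: eventually_sequentially)
  have "norm (h k - 0) < r" if "k \<ge> N + M" for k
  proof -
    have "M \<le> k - N" using that by arith
    then show ?thesis
      using bound[of "k - N"] M[of "k - N"] that mult_left_mono[OF P[of "k - N"], of B]
      by (auto simp: B_def)
  qed
  then show "\<exists>no. \<forall>k\<ge>no. norm (h k - 0) < r" by blast
qed


section \<open>The energy of the iteration\<close>

text \<open>\<open>\<Phi>\<close> and \<open>G\<close> stand for the nonnegative centred values \<open>\<phi>(y)\<close> and \<open>g(x)\<close>. The coefficient \<open>t\<^sup>2 - m t\<close> of \<open>\<Phi>\<close> is the square of the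
preceding weight. The term \<open>(t - 1) \<langle>p, x - c\<rangle>\<close> goes beyond the energy usually attached to Nesterov's
method; it compensates for the fact that a step evaluates \<open>\<nabla>f\<close> at the old point and the subgradient
of \<open>g\<close> at the new one.\<close>

definition energy ::
  "real \<Rightarrow> real \<Rightarrow> real \<Rightarrow> 'a::real_inner \<Rightarrow> 'a \<Rightarrow> 'a \<Rightarrow> real \<Rightarrow> 'a \<Rightarrow> real \<Rightarrow> real" where
  "energy s m t y x p \<Phi> c G = (norm (x + (t - 1) *\<^sub>R (x - y) - c))\<^sup>2 / (2 * s)
     + (t - 1) * inner p (x - c) + (t\<^sup>2 - m * t) * \<Phi> + (t\<^sup>2 - t + 1) * G"

text \<open>The vector \<open>U = x + (t - 1) (x - y) - c\<close> changes by \<open>-s (t q + v)\<close>, so the square contributes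
\<open>-\<langle>t q + v, U\<rangle> + (s/2) \<parallel>t q + v\<parallel>\<^sup>2\<close>. Written in terms of \<open>y'\<close>, \<open>U\<close> turns \<open>\<langle>q, U\<rangle>\<close> into convexity gaps of \<open>\<phi>\<close>; written
in terms of \<open>x'\<close>, it turns \<open>\<langle>v, U\<rangle>\<close> into convexity gaps of \<open>g\<close>, once the change of
\<open>(t - 1) \<langle>p, x - c\<rangle>\<close> has cancelled the contributions with the wrong sign. The function values telescope because \<open>r\<^sup>2 - m r = t\<^sup>2\<close>
and \<open>m \<le> 1\<close>. The remaining quadratic form \<open>-(s/2) (t\<^sup>2 \<parallel>q\<parallel>\<^sup>2 + 2 (r - 1) \<langle>q, v\<rangle> + \<parallel>v\<parallel>\<^sup>2)\<close> is
the claimed decrease after completing the square.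

The gap of \<open>\<phi>\<close> between \<open>y\<close> and \<open>y'\<close> is multiplied by \<open>t - 1\<close> so that it holds trivially in the initial step,
where \<open>t = 1\<close> and \<open>y\<close> does not come from a gradient step.\<close>

lemma energy_step:
  fixes x y p q x' y' p' c :: "'a::real_inner"
  assumes s: "s > 0" and t: "1 \<le> t" "1 \<le> r" "r\<^sup>2 - m * r = t\<^sup>2" "m \<le> 1"
    and y': "y' = x - s *\<^sub>R q"
    and x': "r *\<^sub>R x' = (r + t - 1) *\<^sub>R (y' - s *\<^sub>R p') - (t - 1) *\<^sub>R (y - s *\<^sub>R p)"
    and \<Phi>c: "\<Phi>' \<le> inner q (y' - c)"
    and \<Phi>y: "(t - 1) * (\<Phi>' - \<Phi>) \<le> (t - 1) * inner q (y' - y)"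
    and Gc: "G' \<le> inner p' (x' - c)"
    and Gx': "G' - G \<le> inner p' (x' - x)"
    and Gx: "inner p (x' - x) \<le> G' - G"
    and nonneg: "0 \<le> \<Phi>" "0 \<le> G"
  defines "v \<equiv> (t + r - 1) *\<^sub>R p' - (t - 1) *\<^sub>R p"
  shows "energy s m r y' x' p' \<Phi>' c G'
      + s / 2 * ((norm (v + (r - 1) *\<^sub>R q))\<^sup>2 + (t\<^sup>2 - (r - 1)\<^sup>2) * (norm q)\<^sup>2)
    \<le> energy s m t y x p \<Phi> c G"
proof -
  define U where "U = x + (t - 1) *\<^sub>R (x - y) - c"
  define U' where "U' = x' + (r - 1) *\<^sub>R (x' - y') - c"
  have U'_eq: "U' = U - s *\<^sub>R (t *\<^sub>R q + v)"
  proof -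
    have "U' = r *\<^sub>R x' - (r - 1) *\<^sub>R y' - c"
      by (simp add: U'_def algebra_simps)
    also have "\<dots> = t *\<^sub>R y' - (t - 1) *\<^sub>R y - s *\<^sub>R v - c"
      unfolding x' v_def by (simp add: algebra_simps)
    also have "\<dots> = U - s *\<^sub>R (t *\<^sub>R q + v)"
      unfolding y' U_def by (simp add: algebra_simps)
    finally show ?thesis .
  qed
  have U1: "U = (y' - c) + (t - 1) *\<^sub>R (y' - y) + (s * t) *\<^sub>R q"
    unfolding y' U_def by (simp add: algebra_simps)
  have U2: "U = (x' - c) + (r - 1) *\<^sub>R (x' - x) + s *\<^sub>R ((t + r - 1) *\<^sub>R q + v)"
  proof -
    have "U = U' + s *\<^sub>R (t *\<^sub>R q + v)" by (simp add: U'_eq)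
    then show ?thesis unfolding U'_def y' by (simp add: algebra_simps)
  qed
  have qU: "t * inner q U \<ge> t * \<Phi>' + t * (t - 1) * (\<Phi>' - \<Phi>) + s * t\<^sup>2 * inner q q"
  proof -
    have "t * inner q U = t * inner q (y' - c) + t * ((t - 1) * inner q (y' - y)) + s * t\<^sup>2 * inner q q"
      unfolding U1 by (simp add: inner_add_right power2_eq_square algebra_simps)
    then show ?thesis
      using mult_left_mono[OF \<Phi>c, of t] mult_left_mono[OF \<Phi>y, of t] t(1)
      unfolding mult.assoc by linarith
  qed
  have vU: "inner v U - (r - 1) * inner p' (x' - c) + (t - 1) * inner p (x - c)
     \<ge> (r\<^sup>2 - r + 1) * G' - (r\<^sup>2 - r + 1 - t) * G + s * ((t + r - 1) * inner q v + inner v v)"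
  proof -
    define a a' b b' w w' where defs: "a = inner p (x - c)" "a' = inner p' (x' - c)"
      "b = inner p (x' - x)" "b' = inner p' (x' - x)"
      "w = inner p ((t + r - 1) *\<^sub>R q + v)" "w' = inner p' ((t + r - 1) *\<^sub>R q + v)"
    have "U = (x - c) + r *\<^sub>R (x' - x) + s *\<^sub>R ((t + r - 1) *\<^sub>R q + v)"
      unfolding U2 by (simp add: algebra_simps)
    then have pU: "inner p U = a + r * b + s * w"
      by (simp only: inner_add_right inner_scaleR_right defs)
    have p'U: "inner p' U = a' + (r - 1) * b' + s * w'"
      unfolding U2 by (simp only: inner_add_right inner_scaleR_right defs)
    have "inner v U = (t + r - 1) * (a' + (r - 1) * b' + s * w') - (t - 1) * (a + r * b + s * w)"
      unfolding pU[symmetric] p'U[symmetric] by (simp add: v_def inner_diff_left)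
    moreover have "(t + r - 1) * inner q v + inner v v = (t + r - 1) * w' - (t - 1) * w"
    proof -
      have "inner v ((t + r - 1) *\<^sub>R q + v) = (t + r - 1) * w' - (t - 1) * w"
        unfolding defs by (subst v_def) (simp only: inner_diff_left inner_scaleR_left)
      then show ?thesis by (simp add: inner_add_right inner_commute)
    qed
    ultimately have "inner v U - (r - 1) * a' + (t - 1) * a
      = t * a' + (t + r - 1) * (r - 1) * b' - (t - 1) * r * b
       + s * ((t + r - 1) * inner q v + inner v v)"
      by algebra
    moreover have "t * G' \<le> t * a'"
      unfolding defs using Gc t by (intro mult_left_mono) auto
    moreover have "(t + r - 1) * (r - 1) * (G' - G) \<le> (t + r - 1) * (r - 1) * b'"
      unfolding defs using Gx' t by (intro mult_left_mono) auto
    moreover have "(t - 1) * r * b \<le> (t - 1) * r * (G' - G)"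
      unfolding defs using Gx t by (intro mult_left_mono) auto
    ultimately show ?thesis
      unfolding defs(1,2)[symmetric] by (simp add: power2_eq_square algebra_simps)
  qed
  have "(norm U')\<^sup>2 / (2 * s) = (norm U)\<^sup>2 / (2 * s) - (t * inner q U + inner v U)
    + s / 2 * (t\<^sup>2 * inner q q + 2 * t * inner q v + inner v v)"
    unfolding U'_eq power2_norm_eq_inner using s
    by (simp add: inner_simps inner_commute field_simps power2_eq_square)
  moreover have "s / 2 * ((norm (v + (r - 1) *\<^sub>R q))\<^sup>2 + (t\<^sup>2 - (r - 1)\<^sup>2) * (norm q)\<^sup>2)
      = s / 2 * (inner v v + 2 * (r - 1) * inner q v + t\<^sup>2 * inner q q)"
    unfolding power2_norm_eq_inner by (simp add: inner_simps inner_commute power2_eq_square algebra_simps)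
  moreover have "m * t \<le> t" using t by (simp add: mult_left_le_one_le)
  then have "t * (t - 1) * \<Phi> \<le> (t\<^sup>2 - m * t) * \<Phi>"
    using nonneg by (intro mult_right_mono) (auto simp: power2_eq_square algebra_simps)
  moreover have "m * r \<le> r" using t by (simp add: mult_left_le_one_le)
  then have "(r\<^sup>2 - r + 1 - t) * G \<le> (t\<^sup>2 - t + 1) * G"
    using nonneg t(3) by (intro mult_right_mono) linarith+
  moreover have "(r\<^sup>2 - m * r) * \<Phi>' = t * \<Phi>' + t * (t - 1) * \<Phi>'"
    using t(3) by (simp add: power2_eq_square algebra_simps)
  ultimately show ?thesis
    using qU vU unfolding energy_def U_def[symmetric] U'_def[symmetric]
    by (simp only: distrib_left distrib_right left_diff_distrib right_diff_distrib mult.assoc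
        mult.left_commute[of s] times_divide_eq_left mult_1_left)
qed

text \<open>The weights solve \<open>t\<^sub>k\<^sub>+\<^sub>1\<^sup>2 - m t\<^sub>k\<^sub>+\<^sub>1 = t\<^sub>k\<^sup>2\<close> and grow linearly, by an amount between \<open>m / 2\<close> and \<open>m\<close> in each step.\<close>

locale momentum_weights =
  fixes m :: real and t :: "nat \<Rightarrow> real"
  assumes m_pos: "m > 0" and m_le: "m \<le> 1"
    and t_0: "t 0 = 1"
    and t_Suc: "\<And>k. t (Suc k) = (m + sqrt (m\<^sup>2 + 4 * (t k)\<^sup>2)) / 2"
begin

lemma t_ge_1: "1 \<le> t k"
  and t_increment: "t k + m / 2 \<le> t (Suc k)" "t (Suc k) \<le> t k + m"
  and t_recurrence: "(t (Suc k))\<^sup>2 - m * t (Suc k) = (t k)\<^sup>2"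
proof -
  have inc: "t k + m / 2 \<le> t (Suc k)" "t (Suc k) \<le> t k + m" if "0 \<le> t k" for k
  proof -
    have "2 * t k \<le> sqrt (m\<^sup>2 + 4 * (t k)\<^sup>2)"
      using that by (intro real_le_rsqrt) (simp add: power_mult_distrib)
    moreover have "sqrt (m\<^sup>2 + 4 * (t k)\<^sup>2) \<le> m + 2 * t k"
      using that m_pos by (intro real_le_lsqrt) (auto simp: power2_eq_square algebra_simps)
    ultimately show "t k + m / 2 \<le> t (Suc k)" "t (Suc k) \<le> t k + m"
      by (auto simp: t_Suc)
  qed
  show ge: "1 \<le> t k" for k
  proof (induction k)
    case (Suc k)
    then show ?case using inc(1)[of k] m_pos by linarith
  qed (simp add: t_0)
  show "t k + m / 2 \<le> t (Suc k)" "t (Suc k) \<le> t k + m"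
    using inc[of k] ge[of k] by auto
  have "2 * t (Suc k) - m = sqrt (m\<^sup>2 + 4 * (t k)\<^sup>2)"
    by (simp add: t_Suc field_simps)
  then have "(2 * t (Suc k) - m)\<^sup>2 = m\<^sup>2 + 4 * (t k)\<^sup>2"
    by simp
  then show "(t (Suc k))\<^sup>2 - m * t (Suc k) = (t k)\<^sup>2"
    by (simp add: power2_eq_square algebra_simps)
qed

lemma t_le: "t k \<le> real (Suc k)"
proof (induction k)
  case (Suc k)
  then show ?case using t_increment(2)[of k] m_le by simp
qed (simp add: t_0)

lemma t_at_top: "filterlim t at_top sequentially"
proof (rule filterlim_at_top_mono)
  have "1 + (m / 2) * real k \<le> t k" for k
  proof (induction k)
    case (Suc k)
    moreover have "1 + m / 2 * real (Suc k) = (1 + m / 2 * real k) + m / 2"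
      by (simp add: field_simps)
    ultimately show ?case using t_increment(1)[of k] by linarith
  qed (simp add: t_0)
  then show "\<forall>\<^sub>F k in sequentially. 1 + (m / 2) * real k \<le> t k" by simp
  show "filterlim (\<lambda>k. 1 + (m / 2) * real k) at_top sequentially"
    using m_pos
    by (intro filterlim_tendsto_add_at_top[OF tendsto_const]
          filterlim_tendsto_pos_mult_at_top[OF tendsto_const] filterlim_real_sequentially) auto
qed

lemma momentum_tendsto_1: "(\<lambda>k. (t k - 1) / t (Suc k)) \<longlonglongrightarrow> 1"
proof -
  have "(\<lambda>k. 2 / t (Suc k)) \<longlonglongrightarrow> 0"
    by (intro LIMSEQ_Suc tendsto_divide_0[OF tendsto_const] filterlim_at_top_imp_at_infinity t_at_top)
  then show ?thesis
  proof (rule LIM_zero_cancel[OF Lim_null_comparison, rotated], intro always_eventually allI)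
    fix k
    show "norm ((t k - 1) / t (Suc k) - 1) \<le> 2 / t (Suc k)"
    proof -
      have "(t k - 1) / t (Suc k) - 1 = - ((t (Suc k) - t k + 1) / t (Suc k))"
        using t_ge_1[of "Suc k"] by (simp add: field_simps)
      moreover have "(t (Suc k) - t k + 1) / t (Suc k) \<le> 2 / t (Suc k)"
        "0 \<le> (t (Suc k) - t k + 1) / t (Suc k)"
        using t_increment[of k] t_ge_1[of "Suc k"] m_pos m_le
        by (auto intro!: divide_right_mono divide_nonneg_nonneg)
      ultimately show ?thesis by simp
    qed
  qed
qed

end

text \<open>The centred iteration. The vectors \<open>q k\<close> and \<open>p k\<close> are subgradients of two convex functions at \<open>y (Suc k)\<close> and \<open>x k\<close>,
and \<open>\<Phi> (Suc k)\<close> and \<open>G k\<close> are the values there. Of the two functions only the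
subgradient inequalities between consecutive iterates, and between an iterate and a common
minimizer (where both values are \<open>0\<close>), enter; \<open>S\<close> is the set of these minimizers.\<close>

locale accelerated_alternating_proximal =
  momentum_weights m t for m t +
  fixes s :: real and \<Phi> G :: "nat \<Rightarrow> real"
    and x y p q :: "nat \<Rightarrow> 'a::real_inner" and S :: "'a set"
  assumes s_pos: "s > 0"
    and y_Suc: "\<And>k. y (Suc k) = x k - s *\<^sub>R q k"
    and x_Suc: "\<And>k. t (Suc k) *\<^sub>R x (Suc k) =
      (t (Suc k) + t k - 1) *\<^sub>R (y (Suc k) - s *\<^sub>R p (Suc k)) - (t k - 1) *\<^sub>R (y k - s *\<^sub>R p k)"
    and \<Phi>_nonneg: "\<And>k. 0 \<le> \<Phi> k" and G_nonneg: "\<And>k. 0 \<le> G k"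
    and q_minimizer: "\<And>k c. c \<in> S \<Longrightarrow> \<Phi> (Suc k) \<le> inner (q k) (y (Suc k) - c)"
    and q_previous: "\<And>k. k \<ge> 1 \<Longrightarrow> \<Phi> (Suc k) - \<Phi> k \<le> inner (q k) (y (Suc k) - y k)"
    and p_minimizer: "\<And>k c. c \<in> S \<Longrightarrow> G k \<le> inner (p k) (x k - c)"
    and p_previous: "\<And>k. G (Suc k) - G k \<le> inner (p (Suc k)) (x (Suc k) - x k)"
    and p_next: "\<And>k. inner (p k) (x (Suc k) - x k) \<le> G (Suc k) - G k"
    and S_nonempty: "S \<noteq> {}"
begin

definition energy_at :: "'a \<Rightarrow> nat \<Rightarrow> real" where
  "energy_at c k = energy s m (t k) (y k) (x k) (p k) (\<Phi> k) c (G k)"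

text \<open>The vector whose square, besides that of \<open>q k\<close>, is lost in \<open>energy_step\<close>.\<close>

definition residual :: "nat \<Rightarrow> 'a" where
  "residual k = (t k + t (Suc k) - 1) *\<^sub>R p (Suc k) - (t k - 1) *\<^sub>R p k + (t (Suc k) - 1) *\<^sub>R q k"

lemma energy_at_step:
  assumes "c \<in> S"
  shows "energy_at c (Suc k) + s / 2 * ((norm (residual k))\<^sup>2 + ((t k)\<^sup>2 - (t (Suc k) - 1)\<^sup>2) * (norm (q k))\<^sup>2)
    \<le> energy_at c k"
  unfolding energy_at_def residual_def
proof (rule energy_step)
  show "(t k - 1) * (\<Phi> (Suc k) - \<Phi> k) \<le> (t k - 1) * inner (q k) (y (Suc k) - y k)"
    using q_previous[of k] t_ge_1[of k] t_0 by (cases k) (auto intro: mult_left_mono)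
qed (use assms s_pos m_le t_ge_1 t_recurrence y_Suc x_Suc \<Phi>_nonneg G_nonneg q_minimizer p_minimizer
      p_previous p_next in auto)

lemma t_sq_gap: "m / 2 \<le> (t k)\<^sup>2 - (t (Suc k) - 1)\<^sup>2"
proof -
  have "(t k)\<^sup>2 - (t (Suc k) - 1)\<^sup>2 = (2 - m) * t (Suc k) - 1"
    using t_recurrence[of k] by (simp add: power2_eq_square algebra_simps)
  moreover have "1 * t (Suc k) \<le> (2 - m) * t (Suc k)"
    using m_le t_ge_1[of "Suc k"] by (intro mult_right_mono) auto
  ultimately show ?thesis
    using t_increment(1)[of k] t_ge_1[of k] by linarith
qed

lemma energy_at_bounds:
  assumes "c \<in> S"
  shows "0 \<le> energy_at c k" "(norm (x k + (t k - 1) *\<^sub>R (x k - y k) - c))\<^sup>2 \<le> 2 * s * energy_at c k"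
    "((t k)\<^sup>2 - m * t k) * \<Phi> k \<le> energy_at c k" "t k * G k \<le> energy_at c k"
proof -
  have "m * t k \<le> (t k)\<^sup>2"
    using m_le t_ge_1[of k] by (simp add: power2_eq_square mult_mono)
  then have nn: "0 \<le> (norm (x k + (t k - 1) *\<^sub>R (x k - y k) - c))\<^sup>2 / (2 * s)"
    "0 \<le> (t k - 1) * inner (p k) (x k - c)" "0 \<le> ((t k)\<^sup>2 - m * t k) * \<Phi> k"
    using s_pos t_ge_1[of k] order_trans[OF G_nonneg p_minimizer[OF assms], of k] \<Phi>_nonneg[of k] by auto
  have "0 \<le> (t k - 1)\<^sup>2" by simp
  then have "t k \<le> (t k)\<^sup>2 - t k + 1"
    unfolding power2_eq_square by (simp add: algebra_simps)
  then have G: "t k * G k \<le> ((t k)\<^sup>2 - t k + 1) * G k" "0 \<le> t k * G k"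
    using G_nonneg[of k] t_ge_1[of k] by (auto intro: mult_right_mono)
  show "0 \<le> energy_at c k" "((t k)\<^sup>2 - m * t k) * \<Phi> k \<le> energy_at c k" "t k * G k \<le> energy_at c k"
    unfolding energy_at_def energy_def using nn G by linarith+
  have "(norm (x k + (t k - 1) *\<^sub>R (x k - y k) - c))\<^sup>2 / (2 * s) \<le> energy_at c k"
    unfolding energy_at_def energy_def using nn G by linarith
  then show "(norm (x k + (t k - 1) *\<^sub>R (x k - y k) - c))\<^sup>2 \<le> 2 * s * energy_at c k"
    using s_pos by (simp add: field_simps)
qed

lemma energy_at_decreasing:
  assumes "c \<in> S"
  shows "decseq (energy_at c)"
proof (rule decseq_SucI)
  fix k
  have "0 \<le> s / 2 * ((norm (residual k))\<^sup>2 + ((t k)\<^sup>2 - (t (Suc k) - 1)\<^sup>2) * (norm (q k))\<^sup>2)"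
    using s_pos m_pos t_sq_gap[of k] by (intro mult_nonneg_nonneg add_nonneg_nonneg) auto
  then show "energy_at c (Suc k) \<le> energy_at c k"
    using energy_at_step[OF assms, of k] by linarith
qed

lemma energy_at_convergent:
  assumes "c \<in> S"
  shows "convergent (energy_at c)"
  using decseq_convergent[OF energy_at_decreasing[OF assms], of 0] energy_at_bounds(1)[OF assms]
  unfolding convergent_def by blast

lemma energy_at_le_initial: "c \<in> S \<Longrightarrow> energy_at c k \<le> energy_at c 0"
  using energy_at_decreasing by (auto dest: decseqD)

lemma energy_at_decrease_tendsto_0:
  assumes "c \<in> S"
  shows "(\<lambda>k. energy_at c k - energy_at c (Suc k)) \<longlonglongrightarrow> 0"
proof -
  obtain l where "energy_at c \<longlonglongrightarrow> l"
    using energy_at_convergent[OF assms] by (auto simp: convergent_def)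
  then have "(\<lambda>k. energy_at c k - energy_at c (Suc k)) \<longlonglongrightarrow> l - l"
    by (intro tendsto_diff LIMSEQ_Suc)
  then show ?thesis by simp
qed

text \<open>Both squares are bounded by the decrease of a convergent sequence. For \<open>q\<close> this uses that its
coefficient stays above \<open>m / 2\<close>.\<close>

lemma residual_tendsto_0: "residual \<longlonglongrightarrow> 0"
  and q_tendsto_0: "q \<longlonglongrightarrow> 0"
proof -
  obtain c where c: "c \<in> S" using S_nonempty by blast
  have R: "(norm (residual k))\<^sup>2 \<le> 2 / s * (energy_at c k - energy_at c (Suc k))"
    and Q: "(norm (q k))\<^sup>2 \<le> 4 / (s * m) * (energy_at c k - energy_at c (Suc k))" for k
  proof -
    have *: "m / 2 * (norm (q k))\<^sup>2 \<le> ((t k)\<^sup>2 - (t (Suc k) - 1)\<^sup>2) * (norm (q k))\<^sup>2"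
      using t_sq_gap[of k] by (intro mult_right_mono) auto
    have nn: "0 \<le> m / 2 * (norm (q k))\<^sup>2" using m_pos by simp
    have st: "s / 2 * ((norm (residual k))\<^sup>2 + ((t k)\<^sup>2 - (t (Suc k) - 1)\<^sup>2) * (norm (q k))\<^sup>2) \<le> energy_at c k - energy_at c (Suc k)"
      using energy_at_step[OF c, of k] by linarith
    have "s / 2 * (norm (residual k))\<^sup>2 \<le> energy_at c k - energy_at c (Suc k)"
      by (rule order_trans[OF mult_left_mono st]) (use * nn s_pos in auto)
    then show "(norm (residual k))\<^sup>2 \<le> 2 / s * (energy_at c k - energy_at c (Suc k))"
      using s_pos by (simp add: field_simps)
    have "s / 2 * (m / 2 * (norm (q k))\<^sup>2) \<le> energy_at c k - energy_at c (Suc k)"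
      by (rule order_trans[OF mult_left_mono st]) (use * s_pos in \<open>auto simp: add_increasing\<close>)
    then show "(norm (q k))\<^sup>2 \<le> 4 / (s * m) * (energy_at c k - energy_at c (Suc k))"
      using s_pos m_pos by (simp add: field_simps)
  qed
  have lim: "(\<lambda>k. C * (energy_at c k - energy_at c (Suc k))) \<longlonglongrightarrow> 0" for C
    using tendsto_mult_left[OF energy_at_decrease_tendsto_0[OF c], of C] by simp
  have *: "u \<longlonglongrightarrow> 0" if "\<And>k. (norm (u k))\<^sup>2 \<le> C * (energy_at c k - energy_at c (Suc k))" for u :: "nat \<Rightarrow> 'a" and C
  proof -
    have "(\<lambda>k. (norm (u k))\<^sup>2) \<longlonglongrightarrow> 0"
      by (rule tendsto_sandwich[OF _ _ tendsto_const lim[of C]]) (use that in auto)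
    then have "(\<lambda>k. sqrt ((norm (u k))\<^sup>2)) \<longlonglongrightarrow> sqrt 0"
      by (rule tendsto_real_sqrt)
    then show ?thesis by (simp add: tendsto_norm_zero_iff)
  qed
  show "residual \<longlonglongrightarrow> 0" "q \<longlonglongrightarrow> 0"
    using *[of residual] *[of q] R Q by blast+
qed

text \<open>With \<open>q\<close> and the residual tending to \<open>0\<close>, the recursion for \<open>p\<close> contained in the residual contracts by the
factor \<open>(t k - 1) / (t k + t (Suc k) - 1) \<le> 1 / 2\<close>, up to a vanishing error.\<close>

lemma p_tendsto_0: "p \<longlonglongrightarrow> 0"
proof -
  have "(\<lambda>k. norm (p k)) \<longlonglongrightarrow> 0"
  proof (rule contraction_with_vanishing_error)
    fix k
    define T where "T = t k + t (Suc k) - 1"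
    have T: "T \<ge> 1" "2 * (t k - 1) \<le> T" "t (Suc k) - 1 \<le> T"
      using t_ge_1[of k] t_increment(1)[of k] m_pos t_ge_1[of "Suc k"] by (auto simp: T_def)
    have "T *\<^sub>R p (Suc k) = residual k + (t k - 1) *\<^sub>R p k - (t (Suc k) - 1) *\<^sub>R q k"
      by (simp add: residual_def T_def)
    then have "T * norm (p (Suc k)) \<le> norm (residual k) + norm ((t k - 1) *\<^sub>R p k) + norm ((t (Suc k) - 1) *\<^sub>R q k)"
      using T norm_scaleR[of T "p (Suc k)"]
      by (smt (verit) norm_triangle_ineq norm_triangle_ineq4)
    also have "\<dots> = norm (residual k) + (t k - 1) * norm (p k) + (t (Suc k) - 1) * norm (q k)"
      using t_ge_1 by simp
    also have "\<dots> \<le> T * norm (residual k) + (T / 2) * norm (p k) + T * norm (q k)"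
      using T mult_right_mono[of 1 T "norm (residual k)"]
      by (intro add_mono mult_right_mono) auto
    also have "\<dots> = T * (norm (p k) / 2 + (norm (residual k) + norm (q k)))"
      by (simp add: algebra_simps)
    finally show "norm (p (Suc k)) \<le> norm (p k) / 2 + (norm (residual k) + norm (q k))"
      using T by simp
  next
    show "(\<lambda>k. norm (residual k) + norm (q k)) \<longlonglongrightarrow> 0"
      by (intro tendsto_add_zero tendsto_norm_zero residual_tendsto_0 q_tendsto_0)
  qed auto
  then show ?thesis by (simp add: tendsto_norm_zero_iff)
qed

lemma values_tendsto_0: "\<Phi> \<longlonglongrightarrow> 0" "G \<longlonglongrightarrow> 0"
proof -
  obtain c where c: "c \<in> S" using S_nonempty by blast
  have lim: "(\<lambda>k. energy_at c 0 / t k) \<longlonglongrightarrow> 0"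
    by (intro tendsto_divide_0[OF tendsto_const] filterlim_at_top_imp_at_infinity t_at_top)
  have "G k \<le> energy_at c 0 / t k" for k
    using energy_at_bounds(4)[OF c, of k] energy_at_le_initial[OF c, of k] t_ge_1[of k] by (simp add: field_simps)
  then show "G \<longlonglongrightarrow> 0"
    using G_nonneg by (intro tendsto_sandwich[OF _ _ tendsto_const lim]) auto
  have "\<Phi> (Suc k) \<le> energy_at c 0 / t k" for k
  proof -
    have "t k * \<Phi> (Suc k) \<le> (t k)\<^sup>2 * \<Phi> (Suc k)"
      using t_ge_1[of k] \<Phi>_nonneg by (intro mult_right_mono) (auto simp: power2_eq_square)
    then show ?thesis
      using energy_at_bounds(3)[OF c, of "Suc k"] energy_at_le_initial[OF c, of "Suc k"] t_ge_1[of k]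
      unfolding t_recurrence by (simp add: field_simps)
  qed
  then have "(\<lambda>k. \<Phi> (Suc k)) \<longlonglongrightarrow> 0"
    using \<Phi>_nonneg by (intro tendsto_sandwich[OF _ _ tendsto_const lim]) auto
  then show "\<Phi> \<longlonglongrightarrow> 0" by (rule LIMSEQ_imp_Suc)
qed

text \<open>\<open>t k (x k - c)\<close> is the vector bounded by the energy plus \<open>t k - 1\<close> times \<open>y k - c\<close>, so \<open>x k - c\<close> is an average of two vectors;
and \<open>y (Suc k)\<close> is no farther from \<open>c\<close> than \<open>x k\<close>, because \<open>q k\<close> is a subgradient at \<open>y (Suc k)\<close> of a function minimal at \<open>c\<close>.
Hence no step leaves the ball of radius \<open>R\<close>.\<close>

lemma x_bounded: "bounded (range x)"
proof -
  obtain c where c: "c \<in> S" using S_nonempty by blast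
  define R where "R = max (sqrt (2 * s * energy_at c 0)) (norm (y 0 - c))"
  have step: "norm (x k - c) \<le> R" if y: "norm (y k - c) \<le> R" for k
  proof -
    have "(norm (x k + (t k - 1) *\<^sub>R (x k - y k) - c))\<^sup>2 \<le> 2 * s * energy_at c 0"
      using energy_at_bounds(2)[OF c, of k] mult_left_mono[OF energy_at_le_initial[OF c, of k], of "2 * s"] s_pos by linarith
    then have U: "norm (x k + (t k - 1) *\<^sub>R (x k - y k) - c) \<le> R"
      unfolding R_def by (intro max.coboundedI1 real_le_rsqrt)
    have "t k * norm (x k - c) = norm (t k *\<^sub>R (x k - c))"
      using t_ge_1[of k] by simp
    also have "t k *\<^sub>R (x k - c) = (x k + (t k - 1) *\<^sub>R (x k - y k) - c) + (t k - 1) *\<^sub>R (y k - c)"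
      by (simp add: algebra_simps)
    also have "norm \<dots> \<le> R + (t k - 1) * R"
      using t_ge_1[of k] U y by (intro norm_triangle_le add_mono) (auto intro: mult_left_mono)
    finally show ?thesis
      using t_ge_1[of k] by (simp add: algebra_simps)
  qed
  have "norm (y k - c) \<le> R" for k
  proof (induction k)
    case 0 show ?case by (simp add: R_def)
  next
    case (Suc k)
    have "x k - c = (y (Suc k) - c) + s *\<^sub>R q k" by (simp add: y_Suc)
    then have "(norm (x k - c))\<^sup>2 = (norm (y (Suc k) - c))\<^sup>2 + 2 * s * inner (q k) (y (Suc k) - c) + (norm (s *\<^sub>R q k))\<^sup>2"
      by (simp only: power2_norm_eq_inner inner_add_left inner_add_right inner_scaleR_left inner_scaleR_right)
        (simp add: inner_commute algebra_simps)
    moreover have "0 \<le> inner (q k) (y (Suc k) - c)"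
      using order_trans[OF \<Phi>_nonneg q_minimizer[OF c]] .
    ultimately have "(norm (y (Suc k) - c))\<^sup>2 \<le> (norm (x k - c))\<^sup>2"
      using s_pos by simp
    then show ?case using step[OF Suc] by (meson norm_ge_zero order_trans power2_le_imp_le)
  qed
  then have "dist c (x k) \<le> R" for k
    using step by (simp add: dist_norm norm_minus_commute)
  then show ?thesis unfolding bounded_def by blast
qed

text \<open>In the difference of the energies for \<open>c\<close> and \<open>d\<close> the function values cancel, and so does everything else that is not
affine in \<open>c\<close> and \<open>d\<close> except the constants \<open>\<parallel>c\<parallel>\<^sup>2\<close> and \<open>\<parallel>d\<parallel>\<^sup>2\<close>. So \<open>A k\<close>, the inner product of \<open>c - d\<close> with the
extrapolation \<open>x k + (t k - 1) (x k - w k)\<close> along \<open>w k = y k - s p k\<close>, converges. Since that extrapolation at \<open>Suc k\<close> equals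
\<open>t k w (Suc k) - (t k - 1) w k\<close>, the averaging lemma passes the limit on to \<open>w\<close>, and
\<open>x k - w (Suc k) = s (q k + p (Suc k))\<close> tends to \<open>0\<close>.\<close>

lemma inner_x_convergent:
  assumes "c \<in> S" "d \<in> S"
  shows "convergent (\<lambda>k. inner (x k) (c - d))"
proof -
  define A where "A k = inner (x k + (t k - 1) *\<^sub>R (x k - (y k - s *\<^sub>R p k))) (c - d)" for k
  define w where "w k = y k - s *\<^sub>R p k" for k
  have A_eq: "A k = s * (energy_at d k - energy_at c k) + ((norm c)\<^sup>2 - (norm d)\<^sup>2) / 2" for k
    unfolding A_def energy_at_def energy_def power2_norm_eq_inner using s_pos
    by (simp add: inner_simps inner_commute field_simps)
  obtain l where A: "A \<longlonglongrightarrow> l"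
  proof -
    obtain a b where "energy_at c \<longlonglongrightarrow> a" "energy_at d \<longlonglongrightarrow> b"
      using energy_at_convergent assms unfolding convergent_def by blast
    then have "A \<longlonglongrightarrow> s * (b - a) + ((norm c)\<^sup>2 - (norm d)\<^sup>2) / 2"
      unfolding A_eq[abs_def] by (intro tendsto_intros)
    then show ?thesis using that by blast
  qed
  have "(\<lambda>k. inner (w k) (c - d) - l) \<longlonglongrightarrow> 0"
  proof (rule weighted_average_tendsto_zero)
    fix k
    have "x (Suc k) + (t (Suc k) - 1) *\<^sub>R (x (Suc k) - w (Suc k)) = t k *\<^sub>R w (Suc k) - (t k - 1) *\<^sub>R w k"
    proof -
      have "x (Suc k) + (t (Suc k) - 1) *\<^sub>R (x (Suc k) - w (Suc k))
        = t (Suc k) *\<^sub>R x (Suc k) - (t (Suc k) - 1) *\<^sub>R w (Suc k)"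
        by (simp add: algebra_simps)
      then show ?thesis unfolding x_Suc w_def[symmetric] by (simp add: algebra_simps)
    qed
    then have "A (Suc k) = t k * inner (w (Suc k)) (c - d) - (t k - 1) * inner (w k) (c - d)"
      unfolding A_def w_def[symmetric] by (simp only: inner_diff_left inner_scaleR_left)
    then show "t k * (inner (w (Suc k)) (c - d) - l) = (t k - 1) * (inner (w k) (c - d) - l) + (A (Suc k) - l)"
      by (simp only: algebra_simps)
  next
    show "(\<lambda>k. A (Suc k) - l) \<longlonglongrightarrow> 0"
      using LIMSEQ_Suc[OF A] by (simp add: LIM_zero_iff)
  qed (use t_ge_1 t_le in auto)
  then have "(\<lambda>k. (inner (w (Suc k)) (c - d) - l) + s * inner (q k + p (Suc k)) (c - d)) \<longlonglongrightarrow> 0 + s * inner (0 + 0) (c - d)"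
    by (intro tendsto_intros q_tendsto_0 LIMSEQ_Suc[OF p_tendsto_0]) (rule LIMSEQ_Suc)
  moreover have "x k = w (Suc k) + s *\<^sub>R (q k + p (Suc k))" for k
    by (simp add: w_def y_Suc algebra_simps)
  then have "inner (x k) (c - d) = inner (w (Suc k)) (c - d) + s * inner (q k + p (Suc k)) (c - d)" for k
    by (simp only: inner_add_left inner_scaleR_left)
  ultimately have "(\<lambda>k. inner (x k) (c - d) - l) \<longlonglongrightarrow> 0"
    by (simp only: add_diff_eq diff_add_eq add_0 inner_zero_left mult_zero_right)
  then have "(\<lambda>k. inner (x k) (c - d)) \<longlonglongrightarrow> l"
    by (rule LIM_zero_cancel)
  then show ?thesis unfolding convergent_def by blast
qed

end

section \<open>Weak convergence of the iterates\<close>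

theorem theorem7:
  fixes f :: "'a::{real_inner, complete_space} \<Rightarrow> real"
    and g F :: "'a \<Rightarrow> ereal"
    and L s m :: real
    and t lam \<gamma> :: "nat \<Rightarrow> real"
    and x y z :: "nat \<Rightarrow> 'a"
  assumes "L > 0"
    and "convex_on UNIV f"
    and "smooth_with L f"
    and "proper_fun g"
    and "convex_ereal g"
    and "lsc g"
    and F: "\<And>u. F u = ereal (f u) + g u"
    and "argmin_set F \<noteq> {}"
    and "s \<in> {0<..1 / L}"
    and "m \<in> {0<..1}"
    and "t 0 = 1"
    and "\<And>k. k \<ge> 1 \<Longrightarrow> t k = (m + sqrt (m\<^sup>2 + 4 * (t (k - 1))\<^sup>2)) / 2"
    and "\<And>k. lam (k + 1) = (t k - 1) / t (k + 1)"
    and "\<gamma> 0 = s"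
    and "\<And>k. \<gamma> (k + 1) = (1 + lam (k + 1)) * s"
    and "z 0 = y 0 - \<gamma> 0 *\<^sub>R gradient f (y 0)"
    and "x 0 = prox (\<gamma> 0) g (z 0)"
    and "\<And>k. y (k + 1) = x k - s *\<^sub>R gradient f (x k)"
    and "\<And>k. z (k + 1) = y (k + 1) + lam (k + 1) *\<^sub>R (y (k + 1) - y k)
                 + (lam (k + 1) * s / \<gamma> k) *\<^sub>R (z k - x k)"
    and "\<And>k. x (k + 1) = prox (\<gamma> (k + 1)) g (z (k + 1))"
  shows "\<exists>xs. xs \<in> argmin_set F
            \<and> weakly_converges x xs
            \<and> weakly_converges y (xs - s *\<^sub>R gradient f xs)
            \<and> weakly_converges z (xs - (2 * s) *\<^sub>R gradient f xs)"
proof -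
  note L = assms(1) and f_convex = assms(2) and f_smooth = assms(3)
    and g = assms(4,5,6) and F_min = assms(8) and s_range = assms(9) and m_range = assms(10)
    and t_rules = assms(11,12) and lam_Suc = assms(13) and \<gamma>_rules = assms(14,15)
    and x_0 = assms(17) and y_Suc = assms(18) and z_Suc = assms(19) and x_Suc = assms(20)
  define D where "D = gradient f"
  define G where "G u = real_of_ereal (g u)" for u
  define E where "E u = f u + G u" for u
  have s: "s > 0" "L \<le> 1 / s" using s_range L by (auto simp: field_simps)
  have D: "GDERIV f u :> D u" for u
    unfolding D_def using f_smooth by (intro GDERIV_gradient) (simp add: smooth_with_def)
  have D_lip: "norm (D u - D v) \<le> 1 / s * norm (u - v)" for u v
  proof -
    have "norm (D u - D v) \<le> L * norm (u - v)"
      using f_smooth unfolding smooth_with_def D_def lipschitz_on_def by (auto simp: dist_norm)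
    also have "\<dots> \<le> 1 / s * norm (u - v)" using s by (intro mult_right_mono) auto
    finally show ?thesis .
  qed
  note cocoercive = gradient_cocoercive[OF f_convex D s(1) D_lip]
  note G_convex = convex_on_real_of_convex_ereal[OF g(1,2), folded G_def]

  have F_dom: "F u = ereal (E u)" if "u \<in> effective_domain g" for u
    unfolding F E_def G_def by (subst proper_fun_real[OF g(1) that]) simp
  have F_inf: "F u = \<infinity>" if "u \<notin> effective_domain g" for u
    using that by (simp add: F)
  have argmin_iff: "c \<in> argmin_set F \<longleftrightarrow> c \<in> effective_domain g \<and> (\<forall>v\<in>effective_domain g. E c \<le> E v)" for c
  proof
    assume "c \<in> argmin_set F"
    then have le: "F c \<le> F v" for v by (simp add: argmin_set_def is_arg_min_def not_less)
    obtain v0 where "v0 \<in> effective_domain g" using g(1) by (auto simp: proper_fun_def)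
    then have c: "c \<in> effective_domain g" using le[of v0] F_dom[of v0] F_inf[of c] by auto
    then show "c \<in> effective_domain g \<and> (\<forall>v\<in>effective_domain g. E c \<le> E v)"
      using le F_dom by (metis ereal_less_eq(3))
  next
    assume c: "c \<in> effective_domain g \<and> (\<forall>v\<in>effective_domain g. E c \<le> E v)"
    have "F c \<le> F v" for v
      using c F_dom F_inf by (cases "v \<in> effective_domain g") auto
    then show "c \<in> argmin_set F" by (simp add: argmin_set_def is_arg_min_def not_less)
  qed
  have optimality: "G c - inner (D c) (v - c) \<le> G v" if "c \<in> argmin_set F" "v \<in> effective_domain g" for c v
  proof (rule minimizer_imp_subgradient[OF G_convex _ _ _ that(2)])
    show "f u \<le> f c + inner (D c) (u - c) + (1 / s) / 2 * (norm (u - c))\<^sup>2" for u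
      by (rule quadratic_upper_bound[OF D D_lip])
  qed (use that in \<open>auto simp: argmin_iff E_def\<close>)
  obtain c where c: "c \<in> argmin_set F" using F_min by blast
  define D0 where "D0 = D c"
  \<comment> \<open>The negated gradients are subgradients of \<open>g\<close> at minimizers; monotonicity of the subdifferential against cocoercivity of \<open>D\<close> makes them equal.\<close>
  have D_argmin: "D a = D0" if a: "a \<in> argmin_set F" for a
  proof -
    have split: "inner (D a - D c) (a - c) = inner (D a) (a - c) - inner (D c) (a - c)"
      "inner (D a) (c - a) = - inner (D a) (a - c)"
      by (simp_all only: inner_diff_left inner_diff_right minus_diff_eq)
    have "a \<in> effective_domain g" "c \<in> effective_domain g" using a c argmin_iff by blast+
    then have "inner (D a - D c) (a - c) \<le> 0"
      using optimality[OF c, of a] optimality[OF a, of c] split by linarith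
    moreover have "s * (norm (D a - D c))\<^sup>2 \<le> inner (D a - D c) (a - c)"
    proof -
      have "s * (norm (D a - D c))\<^sup>2 = s / 2 * (norm (D a - D c))\<^sup>2 + s / 2 * (norm (D c - D a))\<^sup>2"
        by (simp add: norm_minus_commute[of "D c"])
      then show ?thesis
        using cocoercive[of c a] cocoercive[of a c] split by linarith
    qed
    ultimately have "s * (norm (D a - D c))\<^sup>2 \<le> 0" by linarith
    then have "(norm (D a - D c))\<^sup>2 \<le> 0"
      using s(1) by (simp only: mult_le_0_iff) auto
    then show ?thesis by (simp add: D0_def)
  qed
  have f_argmin: "f a = f c + inner D0 (a - c)" if "a \<in> argmin_set F" for a
  proof -
    have "inner D0 (c - a) = - inner D0 (a - c)" by (simp only: inner_diff_right minus_diff_eq)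
    then show ?thesis
      using cocoercive[of c a] cocoercive[of a c]
      unfolding D_argmin[OF that] D_argmin[OF c] by simp
  qed
  have E_argmin: "E a = E c" if "a \<in> argmin_set F" for a
    using that c by (auto simp: argmin_iff intro: antisym)
  have minorant: "(G c + inner D0 c) + inner (- D0) v \<le> real_of_ereal (g v)" if "v \<in> effective_domain g" for v
    using optimality[OF c that] by (simp add: D0_def G_def inner_diff_right)

  interpret weights: momentum_weights m t
    using m_range t_rules(1) t_rules(2)[of "Suc k" for k] by unfold_locales auto
  have lam_nonneg: "0 \<le> lam (Suc k)" for k
    using lam_Suc[of k] weights.t_ge_1[of k] weights.t_ge_1[of "Suc k"] by simp
  have \<gamma>_pos: "\<gamma> k > 0" for k
    using \<gamma>_rules s lam_nonneg by (cases k) (auto intro!: mult_pos_pos add_pos_nonneg)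
  define p where "p k = (1 / \<gamma> k) *\<^sub>R (z k - x k)" for k
  have x_prox: "x k = prox (\<gamma> k) g (z k)" for k
    using x_0 x_Suc by (cases k) auto
  have x_dom: "x k \<in> effective_domain g" for k
    unfolding x_prox using minorant by (intro prox_minimizes(1)[OF g \<gamma>_pos])
  have p: "G (x k) + inner (p k) (v - x k) \<le> G v" if "v \<in> effective_domain g" for k v
    using prox_subgradient[OF g \<gamma>_pos minorant that, of k "z k"]
    unfolding p_def G_def x_prox[symmetric] .

  \<comment> \<open>Centring: replace \<open>f\<close> by \<open>f - f c - \<langle>D0, \<cdot> - c\<rangle>\<close> and \<open>g\<close> by \<open>g - g c + \<langle>D0, \<cdot> - c\<rangle>\<close>. The value \<open>\<phi> u\<close> is that of the
    function with Moreau envelope \<open>f\<close> at the proximal point of \<open>u\<close>. No such point belongs to \<open>y 0\<close>, so \<open>\<Phi> 0\<close> is a default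
    value.\<close>
  define q where "q k = D (x k) - D0" for k
  define pc where "pc k = p k + D0" for k
  define yc where "yc k = y k + s *\<^sub>R D0" for k
  define \<phi> where "\<phi> u = f u - f c - inner D0 (u - c) - s / 2 * (norm (D u - D0))\<^sup>2" for u
  define \<Phi> where "\<Phi> k = (case k of 0 \<Rightarrow> 0 | Suc j \<Rightarrow> \<phi> (x j))" for k
  define Gc where "Gc k = G (x k) - G c + inner D0 (x k - c)" for k
  \<comment> \<open>Cocoercivity of \<open>D\<close> rewritten as the subgradient inequality of the function with Moreau envelope \<open>f\<close>.\<close>
  have \<phi>: "\<phi> v - \<phi> u \<le> inner (D v - D0) ((v - s *\<^sub>R D v) - (u - s *\<^sub>R D u))" for u v
  proof -
    have "s / 2 * (norm (D u - D v))\<^sup>2 = s / 2 * (norm (D u - D0))\<^sup>2 + s / 2 * (norm (D v - D0))\<^sup>2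
        - s * inner (D v - D0) (D u - D0)"
      unfolding power2_norm_eq_inner by (simp add: inner_simps inner_commute algebra_simps)
    moreover have "inner (D v - D0) ((v - s *\<^sub>R D v) - (u - s *\<^sub>R D u))
      = inner (D v) (v - u) - inner D0 (v - u) - s * (norm (D v - D0))\<^sup>2 + s * inner (D v - D0) (D u - D0)"
      unfolding power2_norm_eq_inner by (simp add: inner_simps inner_commute algebra_simps)
    ultimately show ?thesis
      using cocoercive[of v u] unfolding \<phi>_def by (simp add: inner_diff_right algebra_simps)
  qed
  have \<phi>_argmin: "\<phi> a = 0" if "a \<in> argmin_set F" for a
    using f_argmin[OF that] D_argmin[OF that] by (simp add: \<phi>_def)
  have yc_Suc: "yc (Suc k) = (x k - s *\<^sub>R D (x k)) + s *\<^sub>R D0" for k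
    using y_Suc[of k] by (simp add: yc_def D_def)

  interpret iteration: accelerated_alternating_proximal m t s \<Phi> Gc x yc pc q "argmin_set F"
  proof unfold_locales
    show "s > 0" by fact
    show "yc (Suc k) = x k - s *\<^sub>R q k" for k
      unfolding yc_Suc q_def by (simp add: algebra_simps)
    show "t (Suc k) *\<^sub>R x (Suc k) = (t (Suc k) + t k - 1) *\<^sub>R (yc (Suc k) - s *\<^sub>R pc (Suc k))
        - (t k - 1) *\<^sub>R (yc k - s *\<^sub>R pc k)" for k
    proof -
      have lam: "t (Suc k) * lam (Suc k) = t k - 1"
        using lam_Suc[of k] weights.t_ge_1[of "Suc k"] by simp
      have combine: "r *\<^sub>R ((1 + l) *\<^sub>R u - l *\<^sub>R v) = (r + r * l) *\<^sub>R u - (r * l) *\<^sub>R v" for r l and u v :: 'a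
        by (simp add: algebra_simps)
      have "x (Suc k) = z (Suc k) - \<gamma> (Suc k) *\<^sub>R p (Suc k)"
        using \<gamma>_pos[of "Suc k"] by (simp add: p_def)
      also have "\<dots> = y (Suc k) + lam (Suc k) *\<^sub>R (y (Suc k) - y k) + (lam (Suc k) * s) *\<^sub>R p k
          - ((1 + lam (Suc k)) * s) *\<^sub>R p (Suc k)"
        using z_Suc[of k] \<gamma>_rules(2)[of k] by (simp add: p_def)
      also have "\<dots> = (1 + lam (Suc k)) *\<^sub>R (y (Suc k) - s *\<^sub>R p (Suc k)) - lam (Suc k) *\<^sub>R (y k - s *\<^sub>R p k)"
        by (simp add: algebra_simps)
      finally have "t (Suc k) *\<^sub>R x (Suc k) = (t (Suc k) + t (Suc k) * lam (Suc k)) *\<^sub>R (y (Suc k) - s *\<^sub>R p (Suc k))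
         - (t (Suc k) * lam (Suc k)) *\<^sub>R (y k - s *\<^sub>R p k)"
        using combine[of "t (Suc k)" "lam (Suc k)"] by metis
      then have "t (Suc k) *\<^sub>R x (Suc k) = (t (Suc k) + (t k - 1)) *\<^sub>R (y (Suc k) - s *\<^sub>R p (Suc k))
         - (t k - 1) *\<^sub>R (y k - s *\<^sub>R p k)"
        unfolding lam .
      moreover have "yc j - s *\<^sub>R pc j = y j - s *\<^sub>R p j" for j
        by (simp add: yc_def pc_def algebra_simps)
      ultimately show ?thesis by simp
    qed
    have "0 \<le> \<phi> u" for u
      using cocoercive[of c u] by (simp add: \<phi>_def D0_def)
    then show "0 \<le> \<Phi> k" for k by (simp add: \<Phi>_def split: nat.split)
    show "0 \<le> Gc k" for k
      using optimality[OF c x_dom[of k]] by (simp add: Gc_def D0_def)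
    show "\<Phi> (Suc k) \<le> inner (q k) (yc (Suc k) - a)" if "a \<in> argmin_set F" for k a
      using \<phi>[of "x k" a] unfolding \<phi>_argmin[OF that] D_argmin[OF that] yc_Suc
      by (simp add: \<Phi>_def q_def algebra_simps)
    show "\<Phi> (Suc k) - \<Phi> k \<le> inner (q k) (yc (Suc k) - yc k)" if k: "k \<ge> 1" for k
    proof -
      obtain j where j: "k = Suc j" using k by (cases k) auto
      show ?thesis
        using \<phi>[of "x k" "x j"] unfolding j yc_Suc by (simp add: \<Phi>_def q_def)
    qed
    show "Gc k \<le> inner (pc k) (x k - a)" if a: "a \<in> argmin_set F" for k a
      using p[of a k] E_argmin[OF a] f_argmin[OF a] a
      by (simp add: argmin_iff E_def Gc_def pc_def inner_simps algebra_simps)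
    show "Gc (Suc k) - Gc k \<le> inner (pc (Suc k)) (x (Suc k) - x k)" for k
      using p[OF x_dom[of k], of "Suc k"] by (simp add: Gc_def pc_def inner_simps algebra_simps)
    show "inner (pc k) (x (Suc k) - x k) \<le> Gc (Suc k) - Gc k" for k
      using p[OF x_dom[of "Suc k"], of k] by (simp add: Gc_def pc_def inner_simps algebra_simps)
  qed (rule F_min)

  have E_lim: "(\<lambda>k. E (x k)) \<longlonglongrightarrow> E c"
  proof -
    have "(\<lambda>k. \<Phi> (Suc k) + s / 2 * (norm (q k))\<^sup>2 + Gc k + E c) \<longlonglongrightarrow> 0 + s / 2 * (norm (0::'a))\<^sup>2 + 0 + E c"
      by (intro tendsto_intros iteration.q_tendsto_0 iteration.values_tendsto_0 LIMSEQ_Suc)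
    moreover have "E (x k) = \<Phi> (Suc k) + s / 2 * (norm (q k))\<^sup>2 + Gc k + E c" for k
      by (simp add: E_def \<Phi>_def \<phi>_def q_def Gc_def)
    ultimately show ?thesis by simp
  qed
  define C where "C j = {u. F u \<le> ereal (E c + inverse (real (Suc j)))}" for j
  have C_iff: "u \<in> C j \<longleftrightarrow> u \<in> effective_domain g \<and> E u \<le> E c + inverse (real (Suc j))" for u j
    using F_dom[of u] F_inf[of u] by (cases "u \<in> effective_domain g") (auto simp: C_def simp del: of_nat_Suc)
  have C_Inter: "(\<Inter>j. C j) = argmin_set F"
  proof (intro equalityI subsetI)
    fix u assume u: "u \<in> (\<Inter>j. C j)"
    have "E u \<le> E c"
    proof (rule LIMSEQ_le_const)
      show "(\<lambda>n. E c + inverse (real (Suc n))) \<longlonglongrightarrow> E c"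
        using tendsto_add[OF tendsto_const LIMSEQ_inverse_real_of_nat, of "E c"] by simp
    qed (use u C_iff in blast)
    moreover have "u \<in> effective_domain g" using u C_iff by blast
    ultimately show "u \<in> argmin_set F" using c by (fastforce simp: argmin_iff)
  next
    fix u assume u: "u \<in> argmin_set F"
    then have "u \<in> C j" for j
      using E_argmin[OF u] C_iff[of u j] by (simp add: argmin_iff)
    then show "u \<in> (\<Inter>j. C j)" by blast
  qed
  have "\<exists>xs\<in>(\<Inter>j. C j). weakly_converges x xs"
  proof (rule weakly_convergent_if_inner_convergent)
    fix j
    have "C j = {u. g u \<le> ereal (E c + inverse (real (Suc j)) - f u)}"
    proof (intro set_eqI)
      fix u
      show "u \<in> C j \<longleftrightarrow> u \<in> {u. g u \<le> ereal (E c + inverse (real (Suc j)) - f u)}"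
        by (cases "g u") (auto simp: C_def F simp del: of_nat_Suc)
    qed
    moreover have "continuous_on UNIV f"
      using D unfolding gderiv_def continuous_on_eq_continuous_at[OF open_UNIV]
      by (blast intro: has_derivative_continuous)
    ultimately show "closed (C j)"
      by (auto intro!: lsc_sublevel_closed g(3) continuous_intros simp del: of_nat_Suc)
    have "convex_on (effective_domain g) E"
      unfolding E_def using G_convex f_convex
      by (intro convex_on_add) (auto intro: convex_on_subset simp: convex_on_def)
    then have "convex {u \<in> effective_domain g. E u \<le> E c + inverse (real (Suc j))}"
      by (rule convex_on_sublevel)
    moreover have "C j = {u \<in> effective_domain g. E u \<le> E c + inverse (real (Suc j))}"
      using C_iff by blast
    ultimately show "convex (C j)" by simp
    have "\<forall>\<^sub>F k in sequentially. E (x k) < E c + inverse (real (Suc j))"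
      using E_lim by (rule order_tendstoD) simp
    then show "\<forall>\<^sub>F k in sequentially. x k \<in> C j"
      by eventually_elim (use C_iff x_dom in force)
  qed (use iteration.x_bounded iteration.inner_x_convergent C_Inter in auto)
  then obtain xs where xs: "xs \<in> argmin_set F" "weakly_converges x xs"
    unfolding C_Inter by blast
  have D_xs: "gradient f xs = D0" using D_argmin[OF xs(1)] by (simp add: D_def)

  have "(\<lambda>k. - s *\<^sub>R (q k + D0)) \<longlonglongrightarrow> - s *\<^sub>R (0 + D0)"
    by (intro tendsto_intros iteration.q_tendsto_0)
  from weakly_converges_add_tendsto[OF xs(2) this]
  have "weakly_converges (\<lambda>k. y (Suc k)) (xs - s *\<^sub>R D0)"
    using y_Suc by (simp add: q_def D_def)
  then have y: "weakly_converges y (xs - s *\<^sub>R D0)"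
    unfolding weakly_converges_def by (blast intro: LIMSEQ_imp_Suc)

  have "(\<lambda>k. (1 + (t k - 1) / t (Suc k)) * s) \<longlonglongrightarrow> (1 + 1) * s"
    by (intro tendsto_intros weights.momentum_tendsto_1)
  then have "(\<lambda>k. \<gamma> (Suc k)) \<longlonglongrightarrow> (1 + 1) * s"
    using \<gamma>_rules(2) lam_Suc by simp
  then have \<gamma>_lim: "\<gamma> \<longlonglongrightarrow> (1 + 1) * s" by (rule LIMSEQ_imp_Suc)
  have "(\<lambda>k. \<gamma> k *\<^sub>R (pc k - D0)) \<longlonglongrightarrow> ((1 + 1) * s) *\<^sub>R (0 - D0)"
    by (intro tendsto_intros \<gamma>_lim iteration.p_tendsto_0)
  from weakly_converges_add_tendsto[OF xs(2) this]
  have "weakly_converges (\<lambda>k. x k + \<gamma> k *\<^sub>R p k) (xs - (2 * s) *\<^sub>R D0)"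
    by (simp add: pc_def)
  moreover have "x k + \<gamma> k *\<^sub>R p k = z k" for k
    using \<gamma>_pos[of k] by (simp add: p_def)
  ultimately have z: "weakly_converges z (xs - (2 * s) *\<^sub>R D0)" by simp
  show ?thesis
  proof (intro exI[of _ xs] conjI)
    show "weakly_converges y (xs - s *\<^sub>R gradient f xs)"
      "weakly_converges z (xs - (2 * s) *\<^sub>R gradient f xs)"
      unfolding D_xs by (fact y z)+
  qed (fact xs)+
qed

end
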